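(* Let $\mathcal{P}$ be the Cauchy transform on the unit disk defined below. Let $\alpha\approx 1.086$ be the solution of the equation $$2J_0\left(\frac{2}{\alpha}\right)-\alpha J_1\left(\frac{2}{\alpha}\right)=0,$$ where $J_0,J_1$ are the Bessel functions of the first kind of orders $0$ and $1$. Then $$\|\mathcal{P}\|_{L^2\to L^2}=\sup\{\|\mathcal{P}[\varphi]\|_2:\ \varphi\in L^2(\mathbb{D},\mathrm{d}A),\ \|\varphi\|_2=1\}=\alpha.$$
   Context: $\mathbb{D}=\{z\in\mathbb{C}:|z|<1\}$ and $\mathrm{d}A(z)=\frac{1}{\pi}\,\mathrm{d}x\,\mathrm{d}y$ is the normalized area measure on $\mathbb{D}$; $\|\varphi\|_p=(\int_{\mathbb{D}}|\varphi|^p\mathrm{d}A)^{1/p}$. For $\varphi\in L^p(\mathbb{D},\mathrm{d}A)$, $1\le p\le\infty$, and $z\in\mathbb{D}$, the Cauchy transform on $\mathbb{D}$ is $$\mathcal{P}[\varphi](z)=-\int_{\mathbb{D}}\left(\frac{\varphi(w)}{w-z}+\frac{z\overline{\varphi(w)}}{1-\bar{w}z}\right)\mathrm{d}A(w).$$ (This operator is real-linear but not complex-linear.) The Bessel function is $J_\nu(x)=\sum_{k\ge0}\frac{(-1)^k}{\Gamma(k+\nu+1)k!}(x/2)^{2k+\nu}$. *)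

theory Defs
  imports "HOL-Analysis.Analysis"
begin

definition diskD :: "complex set" where
  "diskD = {z. cmod z < 1}"

text \<open>Bessel function of the first kind, J_nu(x) = sum_k (-1)^k / (Gamma(k+nu+1) k!) (x/2)^(2k+nu).
  Only integer orders 0 and 1 are used, so (x/2)^(2k+nu) is taken with natural exponent.\<close>
definition besselJ :: "nat \<Rightarrow> real \<Rightarrow> real" where
  "besselJ \<nu> x = (\<Sum>k. (-1) ^ k / (Gamma (real k + real \<nu> + 1) * fact k) * (x / 2) ^ (2 * k + \<nu>))"

text \<open>Squared L^2 norm w.r.t. the normalized area measure dA = dx dy / pi on the disk
  (as an extended nonnegative real, so that infinity is allowed).\<close>
definition L2sq :: "(complex \<Rightarrow> complex) \<Rightarrow> ennreal" where
  "L2sq f = ennreal (1 / pi) * (\<integral>\<^sup>+ z. indicator diskD z * ennreal ((cmod (f z))\<^sup>2) \<partial>lebesgue)"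

definition L2norm :: "(complex \<Rightarrow> complex) \<Rightarrow> ennreal" where
  "L2norm f = (if L2sq f = \<infinity> then \<infinity> else ennreal (sqrt (enn2real (L2sq f))))"

definition L2D :: "(complex \<Rightarrow> complex) set" where
  "L2D = {f. f \<in> borel_measurable lebesgue \<and> L2sq f < \<infinity>}"

definition cauchyP :: "(complex \<Rightarrow> complex) \<Rightarrow> complex \<Rightarrow> complex" where
  "cauchyP \<phi> z = - ((1 / pi) *\<^sub>R
     (LINT w:diskD|lebesgue. \<phi> w / (w - z) + z * cnj (\<phi> w) / (1 - cnj w * z)))"

end

theory Submission
  imports Defs
begin

text \<open>
  The function \<open>u = P[\<phi>]\<close> solves \<open>\<partial>u / \<partial>(cnj z) = \<phi>\<close> and is purely imaginary on the unit circle.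
  In angular modes, \<open>u = \<Sum> z\<^sup>m p\<^sub>m(s) + (cnj z)\<^sup>m q\<^sub>m(s)\<close> with \<open>s = |z|\<^sup>2\<close>, \<open>p\<^sub>m(1) = - cnj (q\<^sub>m(1))\<close> and \<open>q\<^sub>0 = 0\<close>.
  Because of this boundary condition the boundary terms cancel in \<open>\<integral>|\<phi>|\<^sup>2 = \<integral>|\<nabla>u|\<^sup>2 / 4\<close>, so for \<open>m \<ge> 1\<close> the
  best constant comes from the first Neumann eigenvalue of the disk, whose eigenfunction is \<open>J\<^sub>1(2r/\<alpha>)\<close> for \<open>m = 1\<close>;
  for \<open>m = 0\<close> there is a Dirichlet condition and the constant is smaller. The sharp one-dimensional
  inequalities come from completing the square with a solution of the Riccati equation. Polynomials in \<open>z\<close> and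
  \<open>cnj z\<close> are finite sums of modes; general \<open>\<phi>\<close> is reached by pointwise convergence of the Cauchy transforms and
  Fatou's lemma.
\<close>

section \<open>Rotation invariance and radial integrals\<close>

text \<open>The conjugate makes the operator only real-linear and couples \<open>p\<close> with
  \<open>q\<close>, but solely through \<open>p 1 = - cnj (q 1)\<close>; the energies see absolute
  values, so |p(1)| = |q(1)| is all that remains of the coupling. For f(r) = r^m p(r^2) the Neumann
  condition f'(1) = 0 reads p'(1) / p(1) = - m / 2. The boundary loss (m/2) (|p(1)|^2 + |q(1)|^2)
  then equals the gain m |q(1)|^2 in the energy of the \<open>cnj w\<close> part, which is why the
  Neumann condition is the relevant one. The equation for \<alpha> has further roots, belonging to
  higher eigenvalues; the lower bound 1.08 singles out the first one, through positivity of the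
  profile. The limit passage is shaped by the kernel 1/(w - z), which is integrable but not square
  integrable: convergence in L^2 does not yield pointwise convergence of the transforms, so bounded
  functions with almost everywhere convergence come first and truncation second.\<close>

lemma nn_integral_lborel_affine:
  fixes f :: "'a::euclidean_space \<Rightarrow> ennreal"
  assumes [measurable]: "f \<in> borel_measurable borel" and "\<bar>c\<bar> = 1"
  shows "(\<integral>\<^sup>+x. f (t + c *\<^sub>R x) \<partial>lborel) = (\<integral>\<^sup>+x. f x \<partial>lborel)"
proof -
  have "(\<integral>\<^sup>+x. f x \<partial>lborel) = (\<integral>\<^sup>+x. f x \<partial>(density (distr lborel borel (\<lambda>x. t + c *\<^sub>R x)) (\<lambda>_. \<bar>c\<bar>^DIM('a))))"
    using lborel_affine[of c t] assms by auto
  also have "\<dots> = (\<integral>\<^sup>+x. f (t + c *\<^sub>R x) \<partial>lborel)"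
    using assms by (simp add: nn_integral_density nn_integral_distr)
  finally show ?thesis ..
qed

text \<open>The classical uniqueness argument for Haar measure: integrate \<open>1\<^sub>A(\<zeta>x) 1\<^sub>B(\<zeta>x + y)\<close>,
  where B is the unit disk, in both orders.\<close>
lemma lborel_distr_rotation:
  fixes \<zeta> :: complex
  assumes "cmod \<zeta> = 1"
  shows "distr lborel borel (\<lambda>w. \<zeta> * w) = lborel"
proof (rule measure_eqI)
  have [measurable]: "(\<lambda>w. \<zeta> * w) \<in> borel_measurable borel"
    by (intro borel_measurable_continuous_onI continuous_intros)
  have z0: "\<zeta> \<noteq> 0" using assms by auto
  fix A :: "complex set" assume "A \<in> sets (distr lborel borel (\<lambda>w. \<zeta> * w))"
  then have A [measurable]: "A \<in> sets borel" by simp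
  define B where "B = ball (0::complex) 1"
  have B [measurable]: "B \<in> sets borel" by (simp add: B_def)
  let ?a = "\<lambda>x. indicator A x :: ennreal" and ?b = "\<lambda>x. indicator B x :: ennreal"
  have "emeasure (distr lborel borel (\<lambda>w. \<zeta> * w)) A * emeasure lborel B
      = (\<integral>\<^sup>+x. ?a (\<zeta> * x) \<partial>lborel) * (\<integral>\<^sup>+y. ?b y \<partial>lborel)"
    by (simp flip: nn_integral_indicator add: nn_integral_distr)
  also have "\<dots> = (\<integral>\<^sup>+x. ?a (\<zeta> * x) * (\<integral>\<^sup>+y. ?b y \<partial>lborel) \<partial>lborel)"
    by (simp add: nn_integral_multc)
  also have "\<dots> = (\<integral>\<^sup>+x. ?a (\<zeta> * x) * (\<integral>\<^sup>+y. ?b (\<zeta> * x + y) \<partial>lborel) \<partial>lborel)"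
    using nn_integral_lborel_affine[of ?b 1] by simp
  also have "\<dots> = (\<integral>\<^sup>+x. (\<integral>\<^sup>+y. ?a (\<zeta> * x) * ?b (\<zeta> * x + y) \<partial>lborel) \<partial>lborel)"
    by (simp add: nn_integral_cmult)
  also have "\<dots> = (\<integral>\<^sup>+y. (\<integral>\<^sup>+x. ?a (\<zeta> * x) * ?b (\<zeta> * x + y) \<partial>lborel) \<partial>lborel)"
    by (rule lborel_pair.Fubini'[symmetric]) measurable
  also have "\<dots> = (\<integral>\<^sup>+y. (\<integral>\<^sup>+x. ?a (\<zeta> * x - y) * ?b (\<zeta> * x) \<partial>lborel) \<partial>lborel)"
  proof (rule nn_integral_cong)
    fix y :: complex
    show "(\<integral>\<^sup>+x. ?a (\<zeta> * x) * ?b (\<zeta> * x + y) \<partial>lborel) = (\<integral>\<^sup>+x. ?a (\<zeta> * x - y) * ?b (\<zeta> * x) \<partial>lborel)"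
      using nn_integral_lborel_affine[of "\<lambda>x. ?a (\<zeta> * x) * ?b (\<zeta> * x + y)" 1 "- (y / \<zeta>)"] z0
      by (simp add: distrib_left right_diff_distrib)
  qed
  also have "\<dots> = (\<integral>\<^sup>+x. (\<integral>\<^sup>+y. ?a (\<zeta> * x - y) * ?b (\<zeta> * x) \<partial>lborel) \<partial>lborel)"
    by (rule lborel_pair.Fubini') measurable
  also have "\<dots> = (\<integral>\<^sup>+x. (\<integral>\<^sup>+y. ?a (\<zeta> * x - y) \<partial>lborel) * ?b (\<zeta> * x) \<partial>lborel)"
    by (simp add: nn_integral_multc)
  also have "\<dots> = (\<integral>\<^sup>+x. (\<integral>\<^sup>+y. ?a y \<partial>lborel) * ?b x \<partial>lborel)"
  proof (rule nn_integral_cong)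
    fix x :: complex
    have "(\<integral>\<^sup>+y. ?a (\<zeta> * x - y) \<partial>lborel) = (\<integral>\<^sup>+y. ?a y \<partial>lborel)"
      using nn_integral_lborel_affine[of ?a "-1" "\<zeta> * x"] by simp
    \<comment> \<open>The disk is invariant under multiplication by \<zeta>. Its area
      \<open>ennreal pi\<close>, neither 0 nor infinite, is cancelled at the end.\<close>
    moreover have "?b (\<zeta> * x) = ?b x" using assms by (simp add: B_def indicator_def norm_mult)
    ultimately show "(\<integral>\<^sup>+y. ?a (\<zeta> * x - y) \<partial>lborel) * ?b (\<zeta> * x) = (\<integral>\<^sup>+y. ?a y \<partial>lborel) * ?b x" by simp
  qed
  also have "\<dots> = emeasure lborel A * emeasure lborel B"
    by (simp add: nn_integral_cmult)
  finally have *: "emeasure (distr lborel borel (\<lambda>w. \<zeta> * w)) A * emeasure lborel B = emeasure lborel A * emeasure lborel B" .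
  have "emeasure lborel B = ennreal pi"
    by (simp add: B_def emeasure_ball unit_ball_vol_2)
  with * show "emeasure (distr lborel borel (\<lambda>w. \<zeta> * w)) A = emeasure lborel A"
    by (simp add: mult.commute[of _ "ennreal pi"] ennreal_mult_cancel_left)
qed simp

lemma integral_lborel_rotation:
  fixes f :: "complex \<Rightarrow> complex"
  assumes "f \<in> borel_measurable borel" "cmod \<zeta> = 1"
  shows "(LINT w|lborel. f (\<zeta> * w)) = (LINT w|lborel. f w)"
proof -
  have "(LINT w|lborel. f w) = (LINT w|distr lborel borel (\<lambda>w. \<zeta> * w). f w)"
    by (simp add: lborel_distr_rotation assms)
  also have "\<dots> = (LINT w|lborel. f (\<zeta> * w))"
    by (rule integral_distr) (use assms in \<open>auto intro!: borel_measurable_continuous_onI continuous_intros\<close>)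
  finally show ?thesis ..
qed

text \<open>The disk |w|^2 <= s has area pi s, linear in s, so the variable s = |w|^2 gives a
  constant density; this is why the radial profiles below are functions of s. Both measures are
  compared on the half lines \<open>{x<..}\<close>, where the left side is the area of an
  annulus.\<close>

lemma distr_cmod_square:
  assumes "0 < R"
  shows "distr (density lborel (indicator (ball (0::complex) R))) borel (\<lambda>w. (cmod w)\<^sup>2)
    = density lborel (\<lambda>s. ennreal pi * indicator {0..R\<^sup>2} s)" (is "?M = ?N")
proof (rule measure_eqI_lessThan)
  have *: "emeasure ?M {x<..} = ennreal (pi * (R\<^sup>2 - min (R\<^sup>2) (max x 0)))" for x
  proof -
    define y where "y = sqrt (min (R\<^sup>2) (max x 0))"
    have y: "0 \<le> y" "y \<le> R" "y\<^sup>2 = min (R\<^sup>2) (max x 0)" using assms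
      by (auto simp: y_def real_le_lsqrt min_def max_def)
    have "emeasure ?M {x<..} = emeasure lborel (ball 0 R \<inter> {w. x < (cmod w)\<^sup>2})"
      by (subst emeasure_distr, measurable)
        (subst emeasure_density, auto simp: vimage_def intro!: borel_measurable_indicator simp flip: indicator_inter_arith)
    \<comment> \<open>For x < 0 the origin belongs to the set as well, so nothing is removed;
      \<open>cball 0 0\<close> would take it away.\<close>
    also have "\<dots> = emeasure lborel (ball 0 R - (if x < 0 then {} else cball (0::complex) y))"
    proof (rule arg_cong[where f="emeasure lborel"], intro set_eqI)
      fix w :: complex
      have "x < (cmod w)\<^sup>2 \<longleftrightarrow> x < 0 \<or> y < cmod w" if "cmod w < R"
      proof (cases "x < 0")
        case True then show ?thesis by (smt (verit) zero_le_power2)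
      next
        case False
        have "(cmod w)\<^sup>2 < R\<^sup>2" using that assms by (simp add: power_strict_mono)
        then have "x < (cmod w)\<^sup>2 \<longleftrightarrow> y\<^sup>2 < (cmod w)\<^sup>2" using y False by auto
        then show ?thesis using False y by (smt (verit) norm_ge_zero power2_less_imp_less power_strict_mono zero_less_numeral)
      qed
      then show "w \<in> ball 0 R \<inter> {w. x < (cmod w)\<^sup>2} \<longleftrightarrow> w \<in> ball 0 R - (if x < 0 then {} else cball 0 y)"
        by (auto simp: not_le)
    qed
    also have "\<dots> = ennreal (pi * (R\<^sup>2 - min (R\<^sup>2) (max x 0)))"
    proof (cases "x < 0 \<or> y = R")
      case True
      then show ?thesis
      proof (cases "x < 0")
        case True then show ?thesis using assms by (simp add: emeasure_ball unit_ball_vol_2)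
      next
        case False
        then have "y = R" using True by simp
        moreover from this have "ball 0 R - cball (0::complex) y = {}" by auto
        ultimately show ?thesis using y False by (simp only: if_False) auto
      qed
    next
      case False
      then have "y < R" using y by simp
      then have "cball 0 y \<subseteq> ball (0::complex) R" by auto
      then have "emeasure lborel (ball 0 R - cball (0::complex) y) = ennreal (pi * R\<^sup>2) - ennreal (pi * y\<^sup>2)"
        using y assms by (subst emeasure_Diff) (auto simp: emeasure_ball emeasure_cball unit_ball_vol_2)
      then show ?thesis using False y by (simp add: ennreal_minus right_diff_distrib)
    qed
    finally show ?thesis .
  qed
  show "emeasure ?M {x<..} < \<infinity>" for x by (simp add: *)
  show "emeasure ?M {x<..} = emeasure ?N {x<..}" for x
  proof -
    have "emeasure ?N {x<..} = ennreal pi * emeasure lborel ({0..R\<^sup>2} \<inter> {x<..})"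
      by (simp add: emeasure_density nn_integral_cmult mult.assoc flip: indicator_inter_arith)
    also have "{0..R\<^sup>2} \<inter> {x<..} = (if x < 0 then {0..R\<^sup>2} else {x<..R\<^sup>2})" by auto
    also have "ennreal pi * emeasure lborel \<dots> = ennreal (pi * (R\<^sup>2 - min (R\<^sup>2) (max x 0)))"
      by (auto simp: max_def min_def ennreal_mult'')
    finally show ?thesis by (simp add: *)
  qed
qed auto

lemma nn_integral_radial:
  assumes [measurable]: "h \<in> borel_measurable borel" and "0 < R"
  shows "(\<integral>\<^sup>+w. indicator (ball (0::complex) R) w * h ((cmod w)\<^sup>2) \<partial>lborel)
    = ennreal pi * (\<integral>\<^sup>+s. indicator {0..R\<^sup>2} s * h s \<partial>lborel)"
proof -
  have "(\<integral>\<^sup>+w. indicator (ball (0::complex) R) w * h ((cmod w)\<^sup>2) \<partial>lborel)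
      = (\<integral>\<^sup>+s. h s \<partial>distr (density lborel (indicator (ball (0::complex) R))) borel (\<lambda>w. (cmod w)\<^sup>2))"
    by (subst nn_integral_distr, measurable) (subst nn_integral_density, auto intro!: borel_measurable_indicator)
  also have "\<dots> = ennreal pi * (\<integral>\<^sup>+s. indicator {0..R\<^sup>2} s * h s \<partial>lborel)"
    using assms by (simp add: distr_cmod_square nn_integral_density nn_integral_cmult mult.assoc)
  finally show ?thesis .
qed

lemma integral_radial:
  fixes h :: "real \<Rightarrow> 'a::{banach, second_countable_topology}"
  assumes [measurable]: "h \<in> borel_measurable borel" and "0 < R"
  shows "(LINT w|lborel. indicator (ball (0::complex) R) w *\<^sub>R h ((cmod w)\<^sup>2))
    = pi *\<^sub>R (LINT s|lborel. indicator {0..R\<^sup>2} s *\<^sub>R h s)"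
proof -
  have 1: "(indicator (ball (0::complex) R) :: complex \<Rightarrow> ennreal) = (\<lambda>w. ennreal (indicator (ball 0 R) w))"
    by (auto simp: indicator_def)
  have 2: "(\<lambda>s. ennreal pi * indicator {0..R\<^sup>2} s) = (\<lambda>s. ennreal (pi * indicator {0..R\<^sup>2} s))"
    by (auto simp: indicator_def)
  have "(LINT w|lborel. indicator (ball (0::complex) R) w *\<^sub>R h ((cmod w)\<^sup>2))
      = (LINT s|distr (density lborel (indicator (ball (0::complex) R))) borel (\<lambda>w. (cmod w)\<^sup>2). h s)"
    by (subst integral_distr, measurable) (subst 1, subst integral_density, auto intro!: borel_measurable_indicator)
  also have "\<dots> = pi *\<^sub>R (LINT s|lborel. indicator {0..R\<^sup>2} s *\<^sub>R h s)"
    using assms by (simp add: distr_cmod_square 2 integral_density flip: scaleR_scaleR)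
  finally show ?thesis .
qed

text \<open>In s = |w - z|^2 the singularity becomes s^(-1/2), which is integrable at 0.\<close>

lemma nn_integral_inverse_cmod_finite:
  "(\<integral>\<^sup>+w. indicator (ball z R) w * ennreal (1 / cmod (w - z)) \<partial>lborel) < \<infinity>"
proof (cases "R > 0")
  case True
  have "(\<integral>\<^sup>+w. indicator (ball z R) w * ennreal (1 / cmod (w - z)) \<partial>lborel)
      = (\<integral>\<^sup>+w. indicator (ball 0 R) w * ennreal (1 / cmod w) \<partial>lborel)"
    using nn_integral_lborel_affine[of "\<lambda>w. indicator (ball z R) w * ennreal (1 / cmod (w - z))" 1 z]
    by (simp add: indicator_def dist_norm)
  \<comment> \<open>At w = 0 both integrands vanish, since 1 / 0 = 0 and 0 powr (-1/2) = 0.\<close>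
  also have "\<dots> = (\<integral>\<^sup>+w. indicator (ball (0::complex) R) w * ennreal (((cmod w)\<^sup>2) powr (-1/2)) \<partial>lborel)"
    by (intro nn_integral_cong) (auto simp: powr_minus powr_half_sqrt inverse_eq_divide)
  also have "\<dots> = ennreal pi * (\<integral>\<^sup>+s. indicator {0..R\<^sup>2} s * ennreal (s powr (-1/2)) \<partial>lborel)"
    using True by (intro nn_integral_radial) auto
  also have "\<dots> < \<infinity>"
  proof -
    have "((\<lambda>s. s powr (-1/2)) has_integral ((R\<^sup>2) powr (-1/2+1) / (-1/2+1))) {0..R\<^sup>2}"
      by (rule has_integral_powr_from_0) auto
    then have "(\<integral>\<^sup>+s. ennreal (indicator {0..R\<^sup>2} s * s powr (-1/2)) \<partial>lborel) = ennreal ((R\<^sup>2) powr (-1/2+1) / (-1/2+1))"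
      by (intro nn_integral_has_integral_lebesgue) auto
    moreover have "(\<integral>\<^sup>+s. indicator {0..R\<^sup>2} s * ennreal (s powr (-1/2)) \<partial>lborel)
        = (\<integral>\<^sup>+s. ennreal (indicator {0..R\<^sup>2} s * s powr (-1/2)) \<partial>lborel)"
      by (intro nn_integral_cong) (auto simp: indicator_def)
    ultimately show ?thesis by (simp add: ennreal_mult_less_top)
  qed
  finally show ?thesis .
next
  case False
  then have "ball z R = {}" by simp
  then show ?thesis by (simp only: indicator_def empty_iff if_False) simp
qed

section \<open>Bessel functions and radial inequalities\<close>

text \<open>The Bessel function of order \<nu> without its factor (x/2)^\<nu>, in the variable t =
  (x/2)^2; classically 0F1(; \<nu>+1; -t) / \<nu>!. It is entire, so profiles built from it are
  smooth in s = r^2 at the origin too.\<close>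

definition bessel_series :: "nat \<Rightarrow> real \<Rightarrow> real" where
  "bessel_series \<nu> t = (\<Sum>k. (-1) ^ k / (fact (k + \<nu>) * fact k) * t ^ k)"

lemma bessel_series_summable:
  "summable (\<lambda>k. (-1) ^ k / (fact (k + \<nu>) * fact k) * t ^ k :: real)"
proof (rule summable_comparison_test'[where N = 0])
  show "summable (\<lambda>k. \<bar>t\<bar> ^ k / fact k)"
    using summable_exp[of "\<bar>t\<bar>"] by (simp add: field_simps)
  show "norm ((-1) ^ n / (fact (n + \<nu>) * fact n) * t ^ n) \<le> \<bar>t\<bar> ^ n / fact n" for n
  proof -
    have "1 * fact n \<le> (fact (n + \<nu>) * fact n :: real)"
      by (intro mult_right_mono) (auto simp: fact_ge_1)
    then have "\<bar>t\<bar> ^ n / (fact (n + \<nu>) * fact n) \<le> \<bar>t\<bar> ^ n / fact n"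
      by (intro divide_left_mono) auto
    then show ?thesis by (simp add: abs_mult power_abs)
  qed
qed

lemma besselJ_eq_series: "besselJ \<nu> x = (x / 2) ^ \<nu> * bessel_series \<nu> ((x / 2)\<^sup>2)"
proof -
  have "besselJ \<nu> x = (\<Sum>k. (x / 2) ^ \<nu> * ((-1) ^ k / (fact (k + \<nu>) * fact k) * ((x / 2)\<^sup>2) ^ k))"
    unfolding besselJ_def
  proof (rule suminf_cong)
    fix k
    have "Gamma (real k + real \<nu> + 1) = fact (k + \<nu>)"
      using Gamma_fact[of "k + \<nu>", where 'a=real] by (simp add: add_ac)
    moreover have "(x / 2) ^ (2 * k + \<nu>) = ((x / 2)\<^sup>2) ^ k * (x / 2) ^ \<nu>"
      by (simp only: power_add power_mult)
    ultimately show "(- 1) ^ k / (Gamma (real k + real \<nu> + 1) * fact k) * (x / 2) ^ (2 * k + \<nu>) =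
      (x / 2) ^ \<nu> * ((- 1) ^ k / (fact (k + \<nu>) * fact k) * ((x / 2)\<^sup>2) ^ k)"
      by simp
  qed
  also have "\<dots> = (x / 2) ^ \<nu> * bessel_series \<nu> ((x / 2)\<^sup>2)"
    unfolding bessel_series_def by (rule suminf_mult[OF bessel_series_summable])
  finally show ?thesis .
qed

text \<open>Differentiating t^(k+1) cancels the factor k + 1 of \<open>fact (Suc k)\<close>, which
  leaves the coefficients of the next order with opposite sign.\<close>

lemma bessel_series_has_derivative:
  "(bessel_series \<nu> has_real_derivative - bessel_series (Suc \<nu>) t) (at t)"
proof -
  let ?c = "\<lambda>k. (-1) ^ k / (fact (k + \<nu>) * fact k) :: real"
  have "((\<lambda>t. \<Sum>k. ?c k * t ^ k) has_real_derivative (\<Sum>k. diffs ?c k * t ^ k)) (at t)"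
    by (rule termdiffs_strong_converges_everywhere) (rule bessel_series_summable)
  moreover have "(\<Sum>k. diffs ?c k * t ^ k) = - bessel_series (Suc \<nu>) t"
    unfolding bessel_series_def
    by (subst suminf_minus[symmetric, OF bessel_series_summable], rule suminf_cong)
      (simp add: diffs_def del: of_nat_Suc)
  ultimately show ?thesis by (simp add: bessel_series_def[abs_def])
qed

text \<open>The three-term recurrence of Bessel functions with the powers of x/2 divided out.
  Combined with the derivative rule it becomes the differential equation of the profile.\<close>

lemma bessel_series_recurrence:
  "bessel_series \<nu> t = real (Suc \<nu>) * bessel_series (Suc \<nu>) t - t * bessel_series (Suc (Suc \<nu>)) t"
proof -
  let ?c = "\<lambda>\<nu> k. (-1) ^ k / (fact (k + \<nu>) * fact k) :: real"
  have S: "(\<lambda>k. ?c \<mu> k * t ^ k) sums bessel_series \<mu> t" for \<mu>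
    unfolding bessel_series_def by (rule summable_sums[OF bessel_series_summable])
  \<comment> \<open>Terms of the second series, moved up one degree by the factor t and with 0 in
    degree 0, so that both series are compared at equal powers of t.\<close>
  define d where "d = (\<lambda>k. case k of 0 \<Rightarrow> 0 | Suc j \<Rightarrow> t * (?c (Suc (Suc \<nu>)) j * t ^ j))"
  have "(\<lambda>k. d (Suc k)) sums (t * bessel_series (Suc (Suc \<nu>)) t)"
    unfolding d_def nat.case by (intro sums_mult S)
  from sums_Suc[OF this] have "d sums (t * bessel_series (Suc (Suc \<nu>)) t)" by (simp add: d_def)
  with S[of "Suc \<nu>"] have "(\<lambda>k. real (Suc \<nu>) * (?c (Suc \<nu>) k * t ^ k) - d k) sums
      (real (Suc \<nu>) * bessel_series (Suc \<nu>) t - t * bessel_series (Suc (Suc \<nu>)) t)"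
    by (intro sums_diff sums_mult)
  moreover have "real (Suc \<nu>) * (?c (Suc \<nu>) k * t ^ k) - d k = ?c \<nu> k * t ^ k" for k
  proof (cases k)
    case (Suc j)
    have F: "fact (k + Suc \<nu>) = (real (Suc \<nu>) + real k) * fact (k + \<nu>)" "fact k = real k * (fact j :: real)"
      "fact (j + Suc (Suc \<nu>)) = (real (Suc \<nu>) + real k) * fact (k + \<nu>)"
      using Suc by (auto simp: algebra_simps)
    have "n / (((n + c) * F) * (c * G)) + 1 / (((n + c) * F) * G) = 1 / (F * (c * G))"
      if "n > 0" "c > 0" "F > 0" "G > 0" for n c F G :: real
      using that by (simp add: divide_simps)
    note n = this[of "real (Suc \<nu>)" "real k" "fact (k + \<nu>)" "fact j"]
    have "d k = - ((-1) ^ k * t ^ k * (1 / (fact (j + Suc (Suc \<nu>)) * fact j)))"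
      using Suc by (simp add: d_def del: fact_Suc)
    then have "real (Suc \<nu>) * (?c (Suc \<nu>) k * t ^ k) - d k = (-1) ^ k * t ^ k *
       (real (Suc \<nu>) / (fact (k + Suc \<nu>) * fact k) + 1 / (fact (j + Suc (Suc \<nu>)) * fact j))"
      by (simp add: distrib_left mult_ac del: fact_Suc of_nat_Suc)
    also have "\<dots> = (-1) ^ k * t ^ k * (1 / (fact (k + \<nu>) * fact k))"
      unfolding F using n Suc by simp
    finally show ?thesis by simp
  qed (simp add: d_def)
  ultimately show ?thesis using S[of \<nu>] sums_unique2 by simp
qed

text \<open>The constant term is 1 and the k-th coefficient is at most 2^(-k) in absolute value, so
  the rest is bounded by (t/2) / (1 - t/2), which is below 1 for t < 1.\<close>

lemma bessel_series_1_pos: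
  assumes "0 \<le> t" "t < 1"
  shows "0 < bessel_series 1 t"
proof -
  let ?c = "\<lambda>k. (-1) ^ k / (fact (k + 1) * fact k) :: real"
  have s: "summable (\<lambda>k. ?c (Suc k) * t ^ Suc k)"
    using bessel_series_summable[of 1 t] by (subst summable_Suc_iff)
  have fac: "2 ^ Suc k \<le> (fact (Suc k + 1) * fact (Suc k) :: real)" for k
  proof (induction k)
    case (Suc k)
    have "(2::real) ^ Suc (Suc k) \<le> 2 * (fact (Suc k + 1) * fact (Suc k))"
      using mult_left_mono[OF Suc, of 2] by (simp only: power_Suc)
    also have "\<dots> \<le> (real (Suc (Suc k)) * real (Suc (Suc (Suc k)))) * (fact (Suc k + 1) * fact (Suc k))"
      by (intro mult_right_mono) (auto simp: field_simps)
    also have "\<dots> = fact (Suc (Suc k) + 1) * fact (Suc (Suc k))" by (simp only: fact_Suc Suc_eq_plus1[symmetric]) (simp add: mult_ac)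
    finally show ?case .
  qed (simp add: numeral_2_eq_2)
  have g: "(\<lambda>k. (t / 2) ^ Suc k) sums ((t/2) * (1 / (1 - t / 2)))"
    unfolding power_Suc using assms by (intro sums_mult geometric_sums) auto
  have "norm (\<Sum>k. ?c (Suc k) * t ^ Suc k) \<le> (\<Sum>k. (t / 2) ^ Suc k)"
  proof (rule norm_suminf_le)
    fix k
    have "norm (?c (Suc k) * t ^ Suc k) = t ^ Suc k / (fact (Suc k + 1) * fact (Suc k))"
      using assms by (simp add: abs_mult)
    also have "\<dots> \<le> t ^ Suc k / 2 ^ Suc k"
      using assms fac[of k] by (intro divide_left_mono) auto
    finally show "norm (?c (Suc k) * t ^ Suc k) \<le> (t / 2) ^ Suc k" by (simp add: power_divide)
  qed (use g sums_summable in blast)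
  also have "\<dots> = (t/2) * (1 / (1 - t / 2))" using g by (simp add: sums_iff)
  also have "\<dots> < 1" using assms by (simp add: field_simps)
  finally have "\<bar>\<Sum>k. ?c (Suc k) * t ^ Suc k\<bar> < 1" by simp
  moreover have "bessel_series 1 t = 1 + (\<Sum>k. ?c (Suc k) * t ^ Suc k)"
    unfolding bessel_series_def using suminf_split_head[OF bessel_series_summable[of 1 t]] by simp
  ultimately show ?thesis by linarith
qed

text \<open>For Y = s f'/f with f > 0, equality in \<open>riccati\<close> is the Euler-Lagrange
  equation (s^(m+1) f')' + l s^m f = 0, and the inequality says that f is a supersolution. The
  integrand minus the derivative of s^m Y |p|^2 is a square plus a nonnegative remainder, so only
  the boundary value at 1 survives. Because 0 ^ 0 = 1, \<open>zero\<close> restricts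
  \<open>Y 0\<close> just for m = 0.\<close>

lemma riccati_inequality:
  fixes p p' :: "real \<Rightarrow> complex" and Y Y' :: "real \<Rightarrow> real"
  assumes p: "\<And>s. s \<in> {0..1} \<Longrightarrow> (p has_vector_derivative p' s) (at s)"
    and p': "continuous_on {0..1} p'"
    and Y: "continuous_on {0..1} Y" "\<And>s. s \<in> {0<..<1} \<Longrightarrow> (Y has_real_derivative Y' s) (at s)"
    and riccati: "\<And>s. s \<in> {0<..<1} \<Longrightarrow> s * Y' s + (Y s)\<^sup>2 + real m * Y s \<le> - l * s"
    and zero: "0 ^ m * Y 0 = 0"
  shows "Y 1 * (cmod (p 1))\<^sup>2 \<le> integral {0..1} (\<lambda>s. s ^ (m + 1) * (cmod (p' s))\<^sup>2 - l * (s ^ m * (cmod (p s))\<^sup>2))"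
proof -
  define I where "I = (\<lambda>s. s ^ (m + 1) * (cmod (p' s))\<^sup>2 - l * (s ^ m * (cmod (p s))\<^sup>2))"
  define N where "N = (\<lambda>s. (cmod (p s))\<^sup>2)"
  define N' where "N' = (\<lambda>s. 2 * (p s \<bullet> p' s))"
  have cp: "continuous_on {0..1} p"
    using p by (meson continuous_at_imp_continuous_on has_vector_derivative_continuous)
  have N: "(N has_real_derivative N' s) (at s)" if "s \<in> {0..1}" for s
    unfolding N_def N'_def power2_norm_eq_inner has_real_derivative_iff_has_vector_derivative
    using bounded_bilinear.has_vector_derivative[OF bounded_bilinear_inner p[OF that] p[OF that]] by (simp add: inner_commute)
  define D where "D = (\<lambda>s. (real m * s ^ (m - 1) * Y s + s ^ m * Y' s) * N s + s ^ m * Y s * N' s)"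
  have cI: "continuous_on {0..1} I"
    unfolding I_def by (intro continuous_intros p' cp)
  \<comment> \<open>Nothing is assumed about \<open>Y'\<close> at the endpoints; the integrand is
    set to \<open>I\<close> there, so that the comparison holds on the closed interval.\<close>
  have "((\<lambda>s. if s \<in> {0<..<1} then D s else I s) has_integral (1 ^ m * Y 1 * N 1 - 0 ^ m * Y 0 * N 0)) {0..1}"
  proof (rule fundamental_theorem_of_calculus_interior)
    show "continuous_on {0..1} (\<lambda>s. s ^ m * Y s * N s)"
      unfolding N_def by (intro continuous_intros Y cp)
    fix s :: real assume s: "s \<in> {0<..<1}"
    have "((\<lambda>s. s ^ m * Y s * N s) has_real_derivative D s) (at s)"
      unfolding D_def using s by (auto intro!: derivative_eq_intros Y N)
    then show "((\<lambda>s. s ^ m * Y s * N s) has_vector_derivative (if s \<in> {0<..<1} then D s else I s)) (at s)"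
      using s by (simp add: has_real_derivative_iff_has_vector_derivative)
  qed simp
  then have "((\<lambda>s. if s \<in> {0<..<1} then D s else I s) has_integral (Y 1 * N 1)) {0..1}"
    using zero by simp
  moreover have "(I has_integral integral {0..1} I) {0..1}"
    using cI by (intro integrable_integral integrable_continuous_real)
  moreover have "(if s \<in> {0<..<1} then D s else I s) \<le> I s" if "s \<in> {0..1}" for s
  proof (cases "s \<in> {0<..<1}")
    case True
    then have s: "0 < s" by simp
    have e: "(cmod (s *\<^sub>R p' s - Y s *\<^sub>R p s))\<^sup>2 = s\<^sup>2 * (cmod (p' s))\<^sup>2 - s * Y s * N' s + (Y s)\<^sup>2 * N s"
      unfolding N_def N'_def power2_norm_eq_inner
      by (simp add: inner_diff_left inner_diff_right inner_commute power2_eq_square algebra_simps)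
    have sm: "s * (real m * s ^ (m - 1)) = real m * s ^ m" by (cases m) auto
    \<comment> \<open>The factor s turns s^(m-1), truncated at m = 0, into s^m. The second summand
      is the slack in the Riccati inequality.\<close>
    have "s * (I s - D s) = s ^ m * ((cmod (s *\<^sub>R p' s - Y s *\<^sub>R p s))\<^sup>2
      + N s * (- l * s - (s * Y' s + (Y s)\<^sup>2 + real m * Y s)))"
    proof -
      have "s * D s = (real m * s ^ m * Y s + s ^ m * (s * Y' s)) * N s + s ^ m * Y s * (s * N' s)"
        unfolding D_def sm[symmetric] by (simp add: algebra_simps)
      then show ?thesis unfolding e by (simp add: I_def N_def power2_eq_square algebra_simps)
    qed
    also have "\<dots> \<ge> 0"
      using s riccati[OF True] by (intro mult_nonneg_nonneg add_nonneg_nonneg) (auto simp: N_def)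
    finally show ?thesis using s True by (simp add: zero_le_mult_iff)
  next
    case False
    then show ?thesis by (simp only: if_False order_refl)
  qed
  ultimately have "Y 1 * N 1 \<le> integral {0..1} I"
    by (rule has_integral_le) blast
  then show ?thesis unfolding I_def N_def .
qed

text \<open>For \<open>m = 0\<close> the constant is far from sharp, and \<open>1.1 - s\<close> serves as a supersolution.\<close>
lemma mode_inequality_0:
  fixes p p' :: "real \<Rightarrow> complex"
  assumes p: "\<And>s. s \<in> {0..1} \<Longrightarrow> (p has_vector_derivative p' s) (at s)"
    and p': "continuous_on {0..1} p'" and "p 1 = 0" "l \<le> 0.9"
  shows "0 \<le> integral {0..1} (\<lambda>s. s ^ (0 + 1) * (cmod (p' s))\<^sup>2 - l * (s ^ 0 * (cmod (p s))\<^sup>2))"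
proof -
  have "(- 1 / (1.1 - 1)) * (cmod (p 1))\<^sup>2 \<le> integral {0..1} (\<lambda>s. s ^ (0 + 1) * (cmod (p' s))\<^sup>2 - l * (s ^ 0 * (cmod (p s))\<^sup>2))"
  \<comment> \<open>This is Y = s f'/f for f = 1.1 - s. Since 1.1 > 1, f has no zero on the
    interval, and 0.9 * 1.1 = 0.99 < 1 makes it a supersolution. The boundary term drops because
    \<open>p 1 = 0\<close>.\<close>
  proof (rule riccati_inequality[where Y = "\<lambda>s. - s / (1.1 - s)" and Y' = "\<lambda>s. - 1.1 / (1.1 - s)\<^sup>2"])
    show "continuous_on {0..1} (\<lambda>s::real. - s / (1.1 - s))"
      by (intro continuous_intros) auto
    fix s :: real assume s: "s \<in> {0<..<1}"
    show "((\<lambda>s. - s / (1.1 - s)) has_real_derivative - 1.1 / (1.1 - s)\<^sup>2) (at s)"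
      using s by (auto intro!: derivative_eq_intros simp: power2_eq_square field_simps)
    have "s * (- 1.1 / (1.1 - s)\<^sup>2) + (- s / (1.1 - s))\<^sup>2 + real 0 * (- s / (1.1 - s)) = - s / (1.1 - s)"
    proof -
      have "D * (- c / E\<^sup>2) + (- D / E)\<^sup>2 + real 0 * (- D / E) = - D / E" if "E = c - D" "E \<noteq> 0" for c D E :: real
        using that by (simp add: power2_eq_square divide_simps) (simp add: algebra_simps)
      from this[of "1.1 - s" "1.1" s] show ?thesis using s by simp
    qed
    also have "\<dots> \<le> - l * s"
    proof -
      have "l \<le> 1 / (1.1 - s)" 
        using mult_mono[OF assms(4), of "1.1 - s" "1.1"] s by (simp add: pos_le_divide_eq)
      then have "l * s \<le> 1 / (1.1 - s) * s" using s by (intro mult_right_mono) auto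
      then show ?thesis by simp
    qed
    finally show "s * (- 1.1 / (1.1 - s)\<^sup>2) + (- s / (1.1 - s))\<^sup>2 + real 0 * (- s / (1.1 - s)) \<le> - l * s" .
  qed (use assms in auto)
  then show ?thesis using assms by simp
qed

text \<open>With f(r) = r b(r^2), \<open>ode\<close> says that f(r) exp(i theta) is an eigenfunction
  of minus the Laplacian with eigenvalue 4 l, and \<open>b_1\<close> says f'(1) = 0.
  \<open>b_pos\<close> permits the quotient b'/b of the Riccati method, and \<open>l_le\<close>
  settles the mode m = 0.\<close>

locale neumann =
  fixes l :: real and b b' b'' :: "real \<Rightarrow> real"
  assumes b: "\<And>s. (b has_real_derivative b' s) (at s)"
    and b': "\<And>s. (b' has_real_derivative b'' s) (at s)"
    and ode: "\<And>s. s * b'' s + 2 * b' s = - l * b s"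
    and b_pos: "\<And>s. s \<in> {0..1} \<Longrightarrow> 0 < b s"
    and b_1: "b 1 + 2 * b' 1 = 0"
    and l_pos: "0 < l" and l_le: "l \<le> 0.9"

text \<open>The profile \<open>b\<close> is \<open>r b(r\<^sup>2) = const J\<^sub>1(2r/\<alpha>)\<close>; the equation for \<open>\<alpha>\<close> is its Neumann condition at \<open>r = 1\<close>.\<close>
lemma neumann_profile_exists:
  fixes \<alpha> :: real
  assumes eq: "2 * besselJ 0 (2 / \<alpha>) - \<alpha> * besselJ 1 (2 / \<alpha>) = 0" and "1.08 \<le> \<alpha>"
  obtains b b' b'' where "neumann (1 / \<alpha>\<^sup>2) b b' b''"
proof -
  define l where "l = 1 / \<alpha>\<^sup>2"
  \<comment> \<open>1.08^2 = 1.1664 exceeds 1 / 0.9, whence l <= 0.9. This also keeps l s below 1,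
    where positivity of the series is known.\<close>
  have "1.08\<^sup>2 \<le> \<alpha>\<^sup>2" using assms(2) by (intro power_mono) auto
  then have l: "0 < l" "l \<le> 0.9" using assms(2) by (auto simp: l_def field_simps power2_eq_square)
  define b where "b s = bessel_series 1 (l * s)" for s
  define b' where "b' s = - l * bessel_series 2 (l * s)" for s
  define b'' where "b'' s = l\<^sup>2 * bessel_series 3 (l * s)" for s
  have D: "((\<lambda>s. bessel_series \<nu> (l * s)) has_real_derivative (- bessel_series (Suc \<nu>) (l * s)) * l) (at s)" for \<nu> s
    by (rule DERIV_chain2[OF bessel_series_has_derivative]) (auto intro!: derivative_eq_intros)
  have 1: "(b has_real_derivative b' s) (at s)" for s
    unfolding b_def b'_def using D[of 1 s] by (simp add: mult_ac numeral_2_eq_2)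
  have 2: "(b' has_real_derivative b'' s) (at s)" for s
    unfolding b'_def b''_def using DERIV_cmult[OF D[of 2 s], of "- l"] by (simp add: power2_eq_square mult_ac)
  have 3: "s * b'' s + 2 * b' s = - l * b s" for s
    using arg_cong[OF bessel_series_recurrence[of 1 "l * s"], of "(*) l"]
    by (simp add: b_def b'_def b''_def power2_eq_square algebra_simps numeral_3_eq_3 numeral_2_eq_2)
  have 4: "0 < b s" if "s \<in> {0..1}" for s
  proof -
    have "l * s \<le> l * 1" using that l by (intro mult_left_mono) auto
    then have "l * s < 1" using l(2) by linarith
    moreover have "0 \<le> l * s" using that l by simp
    ultimately show ?thesis unfolding b_def by (intro bessel_series_1_pos)
  qed
  \<comment> \<open>Write B_k for the series of order k at l. The equation for \<alpha> says 2 B_0 =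
    B_1, and the recurrence B_0 = B_1 - l B_2 turns it into B_1 - 2 l B_2 = 0, the Neumann
    condition.\<close>
  have "bessel_series 0 l = bessel_series 1 l - l * bessel_series 2 l"
    using bessel_series_recurrence[of 0 l] by (simp add: numeral_2_eq_2)
  moreover have "2 * bessel_series 0 l = bessel_series 1 l"
    using eq assms(2) by (simp add: besselJ_eq_series l_def power_divide)
  ultimately have 5: "b 1 + 2 * b' 1 = 0" by (simp add: b_def b'_def)
  have "neumann l b b' b''" using 1 2 3 4 5 l by unfold_locales
  then show ?thesis using that unfolding l_def by blast
qed

text \<open>One b serves all m >= 1: Y is s f'/f for f = s^(-(m-1)/2) b, so that r^m f(r^2) = r
  b(r^2). Passing from order 1 to order m raises the centrifugal term and leaves the slack (m^2 -
  1)/4 in the Riccati inequality. Y stays continuous at 0 even where f blows up, and the Neumann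
  condition gives Y(1) = -1/2 - (m-1)/2 = -m/2.\<close>

lemma (in neumann) mode_inequality_pos:
  fixes p p' :: "real \<Rightarrow> complex"
  assumes p: "\<And>s. s \<in> {0..1} \<Longrightarrow> (p has_vector_derivative p' s) (at s)"
    and p': "continuous_on {0..1} p'" and "0 < m"
  shows "- (real m / 2) * (cmod (p 1))\<^sup>2 \<le> integral {0..1} (\<lambda>s. s ^ (m + 1) * (cmod (p' s))\<^sup>2 - l * (s ^ m * (cmod (p s))\<^sup>2))"
proof -
  define Y where "Y = (\<lambda>s. s * b' s / b s - (real m - 1) / 2)"
  define Y' where "Y' = (\<lambda>s. b' s / b s + s * b'' s / b s - s * (b' s / b s)\<^sup>2)"
  have "Y 1 * (cmod (p 1))\<^sup>2 \<le> integral {0..1} (\<lambda>s. s ^ (m + 1) * (cmod (p' s))\<^sup>2 - l * (s ^ m * (cmod (p s))\<^sup>2))"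
  proof (rule riccati_inequality[where Y' = Y'])
    have "continuous_on {0..1} b" "continuous_on {0..1} b'"
      using b b' by (meson DERIV_continuous continuous_at_imp_continuous_on)+
    then show "continuous_on {0..1} Y"
      unfolding Y_def using b_pos by (intro continuous_intros) (auto simp: less_le)
    fix s :: real assume s: "s \<in> {0<..<1}"
    then have bs: "b s \<noteq> 0" using b_pos[of s] by auto
    show "(Y has_real_derivative Y' s) (at s)"
      unfolding Y_def Y'_def using bs
      by (auto intro!: derivative_eq_intros b b' simp: field_simps power2_eq_square)
    have "s * b'' s / b s = - l - 2 * (b' s / b s)"
      using ode[of s] bs by (simp add: field_simps)
    moreover have "s * (q + (- l - 2 * q) - s * q\<^sup>2) + (s * q - (real m - 1) / 2)\<^sup>2 + real m * (s * q - (real m - 1) / 2)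
      = - l * s - ((real m)\<^sup>2 - 1) / 4" for q
      by (simp add: power2_eq_square field_simps)
    ultimately have "s * Y' s + (Y s)\<^sup>2 + real m * Y s = - l * s - ((real m)\<^sup>2 - 1) / 4"
      unfolding Y_def Y'_def by (simp only: times_divide_eq_right[symmetric])
    then show "s * Y' s + (Y s)\<^sup>2 + real m * Y s \<le> - l * s"
      using \<open>0 < m\<close> by (simp add: one_le_power)
  qed (use assms in auto)
  moreover have "Y 1 = - (real m / 2)"
  proof -
    have "b' 1 = - b 1 / 2" "b 1 > 0" using b_1 b_pos[of 1] by auto
    then show ?thesis by (simp add: Y_def field_simps)
  qed
  ultimately show ?thesis by simp
qed

section \<open>The Cauchy transform of bounded functions\<close>

lemma diskD_eq_ball: "diskD = ball 0 1"
  by (auto simp: diskD_def)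

lemma diskD_borel [measurable]: "diskD \<in> sets borel"
  by (simp add: diskD_eq_ball)

text \<open>The disk lies in \<open>ball z 2\<close>, which reduces the claim to a disk centred at
  the singularity.\<close>

lemma cauchy_kernel_dominator:
  assumes "z \<in> diskD"
  shows "integrable lebesgue (\<lambda>w. indicator diskD w *\<^sub>R (C / cmod (w - z)))"
proof -
  have [measurable]: "(\<lambda>w. indicator diskD w *\<^sub>R (1 / cmod (w - z))) \<in> borel_measurable borel" by measurable
  have "integrable lborel (\<lambda>w. indicator diskD w *\<^sub>R (1 / cmod (w - z)))"
  proof (rule integrableI_bounded)
    have "(\<integral>\<^sup>+w. ennreal (norm (indicator diskD w *\<^sub>R (1 / cmod (w - z)))) \<partial>lborel)
        \<le> (\<integral>\<^sup>+w. indicator (ball z 2) w * ennreal (1 / cmod (w - z)) \<partial>lborel)"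
    proof (rule nn_integral_mono)
      fix w
      have "cmod (z - w) < 2" if "w \<in> diskD"
        using that assms norm_triangle_ineq4[of z w] by (simp add: diskD_def)
      then show "ennreal (norm (indicator diskD w *\<^sub>R (1 / cmod (w - z)))) \<le> indicator (ball z 2) w * ennreal (1 / cmod (w - z))"
        by (auto simp: indicator_def dist_norm)
    qed
    also have "\<dots> < \<infinity>" by (rule nn_integral_inverse_cmod_finite)
    finally show "(\<integral>\<^sup>+w. ennreal (norm (indicator diskD w *\<^sub>R (1 / cmod (w - z)))) \<partial>lborel) < \<infinity>" .
  qed simp
  then have "integrable lebesgue (\<lambda>w. C * (indicator diskD w *\<^sub>R (1 / cmod (w - z))))"
    by (intro integrable_mult_right) (simp add: integrable_completion)
  then show ?thesis by (simp add: mult_ac)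
qed

lemma one_minus_cnj_mult_bound:
  assumes "z \<in> diskD" "w \<in> diskD"
  shows "1 - cmod z \<le> cmod (1 - cnj w * z)" "0 < cmod (1 - cnj w * z)"
proof -
  have "cmod (cnj w * z) \<le> cmod z"
    using assms by (simp add: norm_mult diskD_def mult_left_le_one_le)
  then show "1 - cmod z \<le> cmod (1 - cnj w * z)"
    using norm_triangle_ineq2[of 1 "cnj w * z"] by simp
  then show "0 < cmod (1 - cnj w * z)" using assms unfolding diskD_def by (smt (verit) mem_Collect_eq)
qed

lemma measurable_cauchy_kernels:
  assumes [measurable]: "\<phi> \<in> borel_measurable lebesgue"
  shows "(\<lambda>w. indicator diskD w *\<^sub>R (\<phi> w / (w - z))) \<in> borel_measurable lebesgue"
    "(\<lambda>w. indicator diskD w *\<^sub>R (z * cnj (\<phi> w) / (1 - cnj w * z))) \<in> borel_measurable lebesgue"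
proof -
  have [measurable]: "(\<lambda>w. w - z) \<in> borel_measurable lebesgue" "(\<lambda>w. 1 - cnj w * z) \<in> borel_measurable lebesgue"
    by (intro measurable_completion borel_measurable_continuous_onI continuous_intros; simp)+
  have [measurable]: "(\<lambda>w. cnj (\<phi> w)) \<in> borel_measurable lebesgue"
    by (rule measurable_compose[OF assms]) (intro borel_measurable_continuous_onI continuous_intros)
  have [measurable]: "diskD \<in> sets lebesgue" by simp
  show "(\<lambda>w. indicator diskD w *\<^sub>R (\<phi> w / (w - z))) \<in> borel_measurable lebesgue"
    "(\<lambda>w. indicator diskD w *\<^sub>R (z * cnj (\<phi> w) / (1 - cnj w * z))) \<in> borel_measurable lebesgue"
    by measurable
qed

lemma cauchy_kernels_integrable:
  assumes \<phi>: "\<phi> \<in> borel_measurable lebesgue" "\<And>w. w \<in> diskD \<Longrightarrow> cmod (\<phi> w) \<le> C" and z: "z \<in> diskD"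
  shows "integrable lebesgue (\<lambda>w. indicator diskD w *\<^sub>R (\<phi> w / (w - z)))"
    "integrable lebesgue (\<lambda>w. indicator diskD w *\<^sub>R (z * cnj (\<phi> w) / (1 - cnj w * z)))"
proof -
  show "integrable lebesgue (\<lambda>w. indicator diskD w *\<^sub>R (\<phi> w / (w - z)))"
  proof (rule Bochner_Integration.integrable_bound[OF cauchy_kernel_dominator[OF z, of C]])
    show "AE w in lebesgue. norm (indicator diskD w *\<^sub>R (\<phi> w / (w - z))) \<le> norm (indicator diskD w *\<^sub>R (C / cmod (w - z)))"
      using \<phi>(2) by (intro AE_I2)
        (auto simp: indicator_def norm_divide intro!: divide_right_mono order_trans[OF _ abs_ge_self])
  qed (rule measurable_cauchy_kernels[OF \<phi>(1)])
  have i: "integrable lebesgue (\<lambda>w. indicator diskD w *\<^sub>R (C / (1 - cmod z)))"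
    by (intro integrable_scaleR_left integrable_real_indicator)
      (auto simp: diskD_eq_ball emeasure_ball)
  show "integrable lebesgue (\<lambda>w. indicator diskD w *\<^sub>R (z * cnj (\<phi> w) / (1 - cnj w * z)))"
  proof (rule Bochner_Integration.integrable_bound[OF i])
    show "AE w in lebesgue. norm (indicator diskD w *\<^sub>R (z * cnj (\<phi> w) / (1 - cnj w * z)))
        \<le> norm (indicator diskD w *\<^sub>R (C / (1 - cmod z)))"
    proof (intro AE_I2)
      fix w
      have "norm (z * cnj (\<phi> w) / (1 - cnj w * z)) \<le> \<bar>C / (1 - cmod z)\<bar>" if w: "w \<in> diskD"
      proof -
        have "cmod z * cmod (\<phi> w) \<le> 1 * C"
          using \<phi>(2)[OF w] z by (intro mult_mono) (auto simp: diskD_def)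
        then have "norm (z * cnj (\<phi> w) / (1 - cnj w * z)) \<le> C / (1 - cmod z)"
          using one_minus_cnj_mult_bound[OF z w] z unfolding norm_divide norm_mult complex_mod_cnj
          by (intro frac_le) (auto simp: diskD_def intro: order_trans[OF norm_ge_zero \<phi>(2)[OF w]])
        then show ?thesis by linarith
      qed
      then show "norm (indicator diskD w *\<^sub>R (z * cnj (\<phi> w) / (1 - cnj w * z)))
        \<le> norm (indicator diskD w *\<^sub>R (C / (1 - cmod z)))" by (auto simp: indicator_def)
    qed
  qed (rule measurable_cauchy_kernels[OF \<phi>(1)])
qed

lemma cauchyP_eq:
  assumes "\<phi> \<in> borel_measurable lebesgue" "\<And>w. w \<in> diskD \<Longrightarrow> cmod (\<phi> w) \<le> C" "z \<in> diskD"
  shows "cauchyP \<phi> z = - ((1 / pi) *\<^sub>R ((LINT w|lebesgue. indicator diskD w *\<^sub>R (\<phi> w / (w - z)))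
    + (LINT w|lebesgue. indicator diskD w *\<^sub>R (z * cnj (\<phi> w) / (1 - cnj w * z)))))"
  unfolding cauchyP_def set_lebesgue_integral_def
  by (subst Bochner_Integration.integral_add[symmetric])
    (auto intro: cauchy_kernels_integrable[OF assms] simp: scaleR_add_right)

lemma continuous_bounded_on_diskD:
  fixes f :: "complex \<Rightarrow> complex"
  assumes "continuous_on UNIV f"
  obtains C where "\<And>w. w \<in> diskD \<Longrightarrow> cmod (f w) \<le> C"
proof -
  have "compact (f ` cball 0 1)"
    using assms by (intro compact_continuous_image) (auto intro: continuous_on_subset)
  then obtain C where "\<forall>y \<in> f ` cball 0 1. cmod y \<le> C"
    using compact_imp_bounded bounded_iff by metis
  then show ?thesis by (intro that[of C]) (auto simp: diskD_def)
qed

lemma continuous_measurable_lebesgue: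
  fixes f :: "complex \<Rightarrow> complex"
  assumes "continuous_on UNIV f"
  shows "f \<in> borel_measurable lebesgue"
  using assms by (simp add: borel_measurable_continuous_onI measurable_completion)

lemma cauchyP_add:
  assumes "continuous_on UNIV f" "continuous_on UNIV g" "z \<in> diskD"
  shows "cauchyP (\<lambda>w. f w + g w) z = cauchyP f z + cauchyP g z"
proof -
  obtain C where C: "\<And>w. w \<in> diskD \<Longrightarrow> cmod (f w) \<le> C" using continuous_bounded_on_diskD assms(1) by blast
  obtain D where D: "\<And>w. w \<in> diskD \<Longrightarrow> cmod (g w) \<le> D" using continuous_bounded_on_diskD assms(2) by blast
  note m = continuous_measurable_lebesgue[OF assms(1)] continuous_measurable_lebesgue[OF assms(2)]
  note i = cauchy_kernels_integrable[OF m(1) C assms(3)] cauchy_kernels_integrable[OF m(2) D assms(3)]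
  have "cauchyP (\<lambda>w. f w + g w) z = - ((1 / pi) *\<^sub>R (LINT w|lebesgue.
      (indicator diskD w *\<^sub>R (f w / (w - z)) + indicator diskD w *\<^sub>R (z * cnj (f w) / (1 - cnj w * z)))
    + (indicator diskD w *\<^sub>R (g w / (w - z)) + indicator diskD w *\<^sub>R (z * cnj (g w) / (1 - cnj w * z)))))"
    unfolding cauchyP_def set_lebesgue_integral_def
    by (intro arg_cong[where f="\<lambda>x. - ((1 / pi) *\<^sub>R x)"] Bochner_Integration.integral_cong)
      (auto simp: indicator_def add_divide_distrib distrib_left)
  also have "\<dots> = cauchyP f z + cauchyP g z"
    using i cauchyP_eq[where C=C, OF m(1) _ assms(3)] cauchyP_eq[where C=D, OF m(2) _ assms(3)] C D
    by (simp add: scaleR_add_right)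
  finally show ?thesis .
qed

lemma cauchyP_sum:
  assumes "\<And>i. i \<in> I \<Longrightarrow> continuous_on UNIV (f i)" "z \<in> diskD"
  shows "cauchyP (\<lambda>w. \<Sum>i\<in>I. f i w) z = (\<Sum>i\<in>I. cauchyP (f i) z)"
  using assms
proof (induction I rule: infinite_finite_induct)
  case (insert i I)
  then show ?case by (simp add: cauchyP_add continuous_on_sum)
qed (auto simp: cauchyP_def)

text \<open>The functions on which rotations act by the n-th character. In this form indices add
  under products and change sign under conjugation and inversion, with no polar coordinates
  involved. The zero function has every index.\<close>

definition rot_mode :: "int \<Rightarrow> (complex \<Rightarrow> complex) \<Rightarrow> bool" where
  "rot_mode n f \<longleftrightarrow> (\<forall>t w. f (cis t * w) = cis (of_int n * t) * f w)"

lemma rot_mode_mult: "rot_mode m f \<Longrightarrow> rot_mode n g \<Longrightarrow> rot_mode (m + n) (\<lambda>w. f w * g w)"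
  by (simp add: rot_mode_def distrib_right flip: cis_mult)

lemma rot_mode_cnj: "rot_mode n f \<Longrightarrow> rot_mode (- n) (\<lambda>w. cnj (f w))"
  by (simp add: rot_mode_def cis_cnj)

lemma rot_mode_inverse: "rot_mode n f \<Longrightarrow> rot_mode (- n) (\<lambda>w. inverse (f w))"
  by (simp add: rot_mode_def)

lemma rot_mode_radial: "rot_mode 0 (\<lambda>w. g (cmod w))"
  by (simp add: rot_mode_def norm_mult)

lemma rot_mode_id: "rot_mode 1 (\<lambda>w. w)"
  by (simp add: rot_mode_def)

lemma rot_mode_const: "rot_mode 0 (\<lambda>w. c)"
  by (simp add: rot_mode_def)

lemma rot_mode_power: "rot_mode n f \<Longrightarrow> rot_mode (int k * n) (\<lambda>w. f w ^ k)"
  by (simp add: rot_mode_def power_mult_distrib Complex.DeMoivre mult_ac)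

text \<open>Rotation by pi/n preserves the measure and multiplies f by cis pi = -1, so the integral
  equals its own negative.\<close>

lemma integral_rot_mode_eq_0:
  assumes "f \<in> borel_measurable borel" "rot_mode n f" "n \<noteq> 0"
  shows "(LINT w|lborel. f w) = 0"
proof -
  define t where "t = pi / of_int n"
  have "(LINT w|lborel. f w) = (LINT w|lborel. f (cis t * w))"
    by (rule integral_lborel_rotation[symmetric]) (use assms in auto)
  also have "\<dots> = - (LINT w|lborel. f w)"
    using assms by (simp add: rot_mode_def t_def)
  finally show ?thesis by (simp add: eq_neg_iff_add_eq_0 mult_2[symmetric])
qed

text \<open>Partial sums of \<open>\<Sum>h q\<^sup>k\<close> are \<open>h (1 - q\<^sup>K)/(1 - q)\<close>, hence dominated by twice the absolute value of the limit.\<close>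
lemma integral_geometric_series:
  fixes h q :: "complex \<Rightarrow> complex"
  assumes [measurable]: "h \<in> borel_measurable borel" "q \<in> borel_measurable borel"
    and int: "integrable lborel (\<lambda>w. h w / (1 - q w))"
    and q: "\<And>w. h w \<noteq> 0 \<Longrightarrow> cmod (q w) < 1"
    and zero: "\<And>k. k \<noteq> j \<Longrightarrow> (LINT w|lborel. h w * q w ^ k) = 0"
  shows "(LINT w|lborel. h w / (1 - q w)) = (LINT w|lborel. h w * q w ^ j)"
proof -
  have dom: "integrable lborel (\<lambda>w. 2 * cmod (h w / (1 - q w)))"
    using int by (intro integrable_mult_right integrable_norm)
  have hint: "integrable lborel (\<lambda>w. h w * q w ^ k)" for k
  proof (rule Bochner_Integration.integrable_bound[OF dom])
    show "AE w in lborel. norm (h w * q w ^ k) \<le> norm (2 * cmod (h w / (1 - q w)))"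
    proof (intro AE_I2)
      fix w
      show "norm (h w * q w ^ k) \<le> norm (2 * cmod (h w / (1 - q w)))"
      proof (cases "h w = 0")
        case False
        have q1: "cmod (q w) < 1" using q[OF False] .
        have "1 - q w \<noteq> 0" using q1 by auto
        have "cmod (1 - q w) \<le> 2" using norm_triangle_ineq4[of 1 "q w"] q1 by simp
        then have "cmod (h w) * cmod (q w) ^ k * cmod (1 - q w) \<le> cmod (h w) * 1 * 2"
          using q1 by (intro mult_mono power_le_one) (auto intro: mult_left_le simp: power_le_one)
        then show ?thesis using \<open>1 - q w \<noteq> 0\<close> by (simp add: norm_mult norm_power norm_divide field_simps)
      qed simp
    qed
  qed measurable
  have lim: "(\<lambda>K. LINT w|lborel. (\<Sum>k<K. h w * q w ^ k)) \<longlonglongrightarrow> (LINT w|lborel. h w / (1 - q w))"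
  proof (rule integral_dominated_convergence[OF _ _ dom])
    show "AE w in lborel. (\<lambda>K. \<Sum>k<K. h w * q w ^ k) \<longlonglongrightarrow> h w / (1 - q w)"
    proof (intro AE_I2)
      fix w
      show "(\<lambda>K. \<Sum>k<K. h w * q w ^ k) \<longlonglongrightarrow> h w / (1 - q w)"
      proof (cases "h w = 0")
        case False
        have "(\<lambda>k. h w * q w ^ k) sums (h w * (1 / (1 - q w)))"
          using q[OF False] by (intro sums_mult geometric_sums) auto
        then show ?thesis by (simp add: sums_def)
      qed simp
    qed
    show "AE w in lborel. norm (\<Sum>k<K. h w * q w ^ k) \<le> 2 * cmod (h w / (1 - q w))" for K
    proof (intro AE_I2)
      fix w
      show "norm (\<Sum>k<K. h w * q w ^ k) \<le> 2 * cmod (h w / (1 - q w))"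
      proof (cases "h w = 0")
        case False
        have q1: "cmod (q w) < 1" using q[OF False] .
        have "1 - q w \<noteq> 0" using q1 by auto
        have "cmod (q w) ^ K \<le> 1" using q1 by (intro power_le_one) auto
        then have "cmod (1 - q w ^ K) \<le> 2" using norm_triangle_ineq4[of 1 "q w ^ K"] by (simp add: norm_power)
        moreover have "(\<Sum>k<K. h w * q w ^ k) = (1 - q w ^ K) * (h w / (1 - q w))"
          using \<open>1 - q w \<noteq> 0\<close> by (simp add: sum_distrib_left[symmetric] sum_gp_strict)
        ultimately show ?thesis by (simp add: norm_mult mult_right_mono del: times_divide_eq_right)
      qed simp
    qed
  qed measurable
  \<comment> \<open>Since only the j-th term has a nonzero integral, the integrated partial sums are
    constant once K > j.\<close>
  have "eventually (\<lambda>K. (LINT w|lborel. (\<Sum>k<K. h w * q w ^ k)) = (LINT w|lborel. h w * q w ^ j)) sequentially"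
    using eventually_gt_at_top[of j]
  proof eventually_elim
    case (elim K)
    have "(LINT w|lborel. (\<Sum>k<K. h w * q w ^ k)) = (\<Sum>k<K. LINT w|lborel. h w * q w ^ k)"
      using hint by (intro Bochner_Integration.integral_sum)
    also have "\<dots> = (\<Sum>k<K. if k = j then LINT w|lborel. h w * q w ^ j else 0)"
      using zero by (intro sum.cong) auto
    finally show ?case using elim by simp
  qed
  then have "(\<lambda>K. LINT w|lborel. (\<Sum>k<K. h w * q w ^ k)) \<longlonglongrightarrow> (LINT w|lborel. h w * q w ^ j)"
    by (simp add: tendsto_eventually)
  with lim show ?thesis by (rule LIMSEQ_unique)
qed

section \<open>The Cauchy transform of angular modes\<close>

text \<open>1/(w - z) is -(1/z) times a geometric series in w/z for |w| < |z|, and 1/w times one in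
  z/w for |w| > |z|. \<open>hi\<close> and \<open>ho\<close> are the leading factors on the two
  regions; the circle |w| = |z| is a null set.\<close>

lemma cauchy_integral_split:
  fixes f :: "complex \<Rightarrow> complex"
  assumes f: "continuous_on UNIV f" and z: "z \<in> diskD"
  defines "hi \<equiv> \<lambda>w. (if cmod w < cmod z then - 1 / z else 0) * f w"
    and "ho \<equiv> \<lambda>w. (if cmod z < cmod w \<and> cmod w < 1 then 1 else 0) * f w * inverse w"
  shows "integrable lborel (\<lambda>w. hi w / (1 - w * inverse z))"
    and "integrable lborel (\<lambda>w. ho w / (1 - z * inverse w))"
    and "(LINT w|lebesgue. indicator diskD w *\<^sub>R (f w / (w - z)))
      = (LINT w|lborel. hi w / (1 - w * inverse z)) + (LINT w|lborel. ho w / (1 - z * inverse w))"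
proof -
  have [measurable]: "f \<in> borel_measurable borel" using f by (rule borel_measurable_continuous_onI)
  let ?F = "\<lambda>w. indicator diskD w *\<^sub>R (f w / (w - z))"
  obtain C where C: "\<And>w. w \<in> diskD \<Longrightarrow> cmod (f w) \<le> C" using continuous_bounded_on_diskD f by blast
  have F_borel: "?F \<in> borel_measurable borel" by measurable
  have "integrable lebesgue ?F"
    using cauchy_kernels_integrable(1)[OF continuous_measurable_lebesgue[OF f] _ z] C by blast
  then have F: "integrable lborel ?F" using F_borel by (simp add: integrable_completion)
  have hi_eq: "hi w / (1 - w * inverse z) = indicator (ball 0 (cmod z)) w *\<^sub>R ?F w" for w
  proof (cases "cmod w < cmod z")
    case True
    then have "z \<noteq> 0" "w \<in> diskD" "w - z \<noteq> 0" "z - w \<noteq> 0" using z by (auto simp: diskD_def)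
    then show ?thesis using True by (simp add: hi_def field_simps)
  qed (simp add: hi_def)
  have ho_eq: "ho w / (1 - z * inverse w) = indicator (- cball 0 (cmod z)) w *\<^sub>R ?F w" for w
  proof (cases "cmod z < cmod w \<and> cmod w < 1")
    case True
    then have "w \<noteq> 0" "w \<in> diskD" "w - z \<noteq> 0" "z - w \<noteq> 0" using z by (auto simp: diskD_def)
    then show ?thesis using True by (simp add: ho_def field_simps)
  next
    case False
    then have "ho w = 0" by (auto simp: ho_def)
    moreover have "indicator (- cball 0 (cmod z)) w *\<^sub>R ?F w = 0"
      using False by (auto simp: indicator_def diskD_def not_le)
    ultimately show ?thesis by simp
  qed
  show i: "integrable lborel (\<lambda>w. hi w / (1 - w * inverse z))"
    "integrable lborel (\<lambda>w. ho w / (1 - z * inverse w))"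
    unfolding hi_eq ho_eq by (rule integrable_mult_indicator[OF _ F], simp)+
  have "(LINT w|lebesgue. ?F w) = (LINT w|lborel. ?F w)"
    using F_borel by (intro integral_completion) simp
  also have "\<dots> = (LINT w|lborel. hi w / (1 - w * inverse z) + ho w / (1 - z * inverse w))"
  proof (rule integral_cong_AE)
    have "sphere (0::complex) (cmod z) \<in> null_sets lborel"
      using negligible_sphere[of "0::complex" "cmod z"]
      by (simp add: negligible_iff_null_sets null_sets_completion_iff)
    then have "AE w::complex in lborel. w \<notin> sphere 0 (cmod z)" by (rule AE_not_in)
    then show "AE w in lborel. ?F w = hi w / (1 - w * inverse z) + ho w / (1 - z * inverse w)"
      by eventually_elim (auto simp: hi_eq ho_eq indicator_def)
  qed (use F_borel i in auto)
  also have "\<dots> = (LINT w|lborel. hi w / (1 - w * inverse z)) + (LINT w|lborel. ho w / (1 - z * inverse w))"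
    using i by (rule Bochner_Integration.integral_add)
  finally show "(LINT w|lebesgue. ?F w)
      = (LINT w|lborel. hi w / (1 - w * inverse z)) + (LINT w|lborel. ho w / (1 - z * inverse w))" .
qed

text \<open>The k-th term of the inner series has rotation index n + k, that of the outer series n -
  1 - k. So exactly one term of index 0 survives: an outer one, k = n - 1, for n >= 1, and an inner
  one, k = -n, for n <= 0.\<close>

lemma cauchy_integral_mode:
  fixes f :: "complex \<Rightarrow> complex"
  assumes f: "continuous_on UNIV f" and z: "z \<in> diskD" and mode: "rot_mode n f"
  shows "n = 1 + int m \<Longrightarrow> (LINT w|lebesgue. indicator diskD w *\<^sub>R (f w / (w - z)))
      = (LINT w|lborel. indicator (ball 0 1) w *\<^sub>R (if cmod z < cmod w then z ^ m * (f w * inverse w ^ Suc m) else 0))"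
    and "n = - int m \<Longrightarrow> (LINT w|lebesgue. indicator diskD w *\<^sub>R (f w / (w - z)))
      = (LINT w|lborel. indicator (ball 0 1) w *\<^sub>R (if cmod w < cmod z then - (inverse z ^ Suc m * (f w * w ^ m)) else 0))"
proof -
  have [measurable]: "f \<in> borel_measurable borel" using f by (rule borel_measurable_continuous_onI)
  define hi where "hi = (\<lambda>w. (if cmod w < cmod z then - 1 / z else 0) * f w)"
  define ho where "ho = (\<lambda>w. (if cmod z < cmod w \<and> cmod w < 1 then 1 else 0) * f w * inverse w)"
  have split: "integrable lborel (\<lambda>w. hi w / (1 - w * inverse z))"
    "integrable lborel (\<lambda>w. ho w / (1 - z * inverse w))"
    "(LINT w|lebesgue. indicator diskD w *\<^sub>R (f w / (w - z)))
      = (LINT w|lborel. hi w / (1 - w * inverse z)) + (LINT w|lborel. ho w / (1 - z * inverse w))"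
    unfolding hi_def ho_def by (rule cauchy_integral_split[OF f z])+
  have [measurable]: "hi \<in> borel_measurable borel" "ho \<in> borel_measurable borel"
    unfolding hi_def ho_def by measurable
  have hi_mode: "rot_mode (n + int k) (\<lambda>w. hi w * (w * inverse z) ^ k)" for k
  proof -
    have "rot_mode (0 + n + int k * (1 + 0)) (\<lambda>w. hi w * (w * inverse z) ^ k)"
      unfolding hi_def
      by (intro rot_mode_mult rot_mode_power rot_mode_id rot_mode_const mode
          rot_mode_radial[of "\<lambda>r. if r < cmod z then - 1 / z else 0"])
    then show ?thesis by simp
  qed
  have ho_mode: "rot_mode (n - 1 - int k) (\<lambda>w. ho w * (z * inverse w) ^ k)" for k
  proof -
    have "rot_mode (0 + n + - 1 + int k * (0 + - 1)) (\<lambda>w. ho w * (z * inverse w) ^ k)"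
      unfolding ho_def
      by (intro rot_mode_mult rot_mode_power rot_mode_inverse rot_mode_id rot_mode_const mode
          rot_mode_radial[of "\<lambda>r. if cmod z < r \<and> r < 1 then 1 else 0"])
    then show ?thesis by simp
  qed
  have hi0: "(LINT w|lborel. hi w * (w * inverse z) ^ k) = 0" if "n + int k \<noteq> 0" for k
    using that by (intro integral_rot_mode_eq_0[OF _ hi_mode]) auto
  have ho0: "(LINT w|lborel. ho w * (z * inverse w) ^ k) = 0" if "n - 1 - int k \<noteq> 0" for k
    using that by (intro integral_rot_mode_eq_0[OF _ ho_mode]) auto
  have qi: "cmod (w * inverse z) < 1" if "hi w \<noteq> 0" for w
  proof -
    have "cmod w < cmod z" using that by (auto simp: hi_def split: if_splits)
    moreover from this have "0 < cmod z" by (meson norm_ge_zero le_less_trans)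
    ultimately show ?thesis by (simp add: norm_divide flip: divide_inverse)
  qed
  have qo: "cmod (z * inverse w) < 1" if "ho w \<noteq> 0" for w
  proof -
    have "cmod z < cmod w" using that by (auto simp: ho_def split: if_splits)
    moreover from this have "0 < cmod w" by (meson norm_ge_zero le_less_trans)
    ultimately show ?thesis by (simp add: norm_divide flip: divide_inverse)
  qed
  show "(LINT w|lebesgue. indicator diskD w *\<^sub>R (f w / (w - z)))
      = (LINT w|lborel. indicator (ball 0 1) w *\<^sub>R (if cmod z < cmod w then z ^ m * (f w * inverse w ^ Suc m) else 0))"
    if n: "n = 1 + int m"
  proof -
    \<comment> \<open>All terms of the inner series integrate to 0 here; the 0-th is picked as the
      survivor and removed by \<open>hi0\<close> afterwards.\<close>
    have "(LINT w|lborel. hi w / (1 - w * inverse z)) = (LINT w|lborel. hi w * (w * inverse z) ^ 0)"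
      by (rule integral_geometric_series[OF _ _ split(1) qi hi0]) (use n in auto)
    moreover have "(LINT w|lborel. ho w / (1 - z * inverse w)) = (LINT w|lborel. ho w * (z * inverse w) ^ m)"
      by (rule integral_geometric_series[OF _ _ split(2) qo ho0]) (use n in auto)
    ultimately have "(LINT w|lebesgue. indicator diskD w *\<^sub>R (f w / (w - z))) = (LINT w|lborel. ho w * (z * inverse w) ^ m)"
      using split(3) hi0[of 0] n by simp
    also have "\<dots> = (LINT w|lborel. indicator (ball 0 1) w *\<^sub>R (if cmod z < cmod w then z ^ m * (f w * inverse w ^ Suc m) else 0))"
      by (intro Bochner_Integration.integral_cong) (auto simp: ho_def indicator_def power_mult_distrib)
    finally show ?thesis .
  qed
  show "(LINT w|lebesgue. indicator diskD w *\<^sub>R (f w / (w - z)))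
      = (LINT w|lborel. indicator (ball 0 1) w *\<^sub>R (if cmod w < cmod z then - (inverse z ^ Suc m * (f w * w ^ m)) else 0))"
    if n: "n = - int m"
  proof -
    have "(LINT w|lborel. hi w / (1 - w * inverse z)) = (LINT w|lborel. hi w * (w * inverse z) ^ m)"
      by (rule integral_geometric_series[OF _ _ split(1) qi hi0]) (use n in auto)
    moreover have "(LINT w|lborel. ho w / (1 - z * inverse w)) = (LINT w|lborel. ho w * (z * inverse w) ^ 0)"
      by (rule integral_geometric_series[OF _ _ split(2) qo ho0]) (use n in auto)
    ultimately have "(LINT w|lebesgue. indicator diskD w *\<^sub>R (f w / (w - z))) = (LINT w|lborel. hi w * (w * inverse z) ^ m)"
      using split(3) ho0[of 0] n by simp
    also have "\<dots> = (LINT w|lborel. indicator (ball 0 1) w *\<^sub>R (if cmod w < cmod z then - (inverse z ^ Suc m * (f w * w ^ m)) else 0))"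
      using z by (intro Bochner_Integration.integral_cong)
        (auto simp: hi_def indicator_def power_mult_distrib diskD_def divide_inverse)
    finally show ?thesis .
  qed
qed

text \<open>Expanding 1/(1 - cnj w z) gives terms of rotation index -n - k, which is 0 only for k =
  -n, hence never when n > 0.\<close>

lemma reflected_integral_mode:
  fixes f :: "complex \<Rightarrow> complex"
  assumes f: "continuous_on UNIV f" and z: "z \<in> diskD" and mode: "rot_mode n f"
  shows "n > 0 \<Longrightarrow> (LINT w|lebesgue. indicator diskD w *\<^sub>R (z * cnj (f w) / (1 - cnj w * z))) = 0"
    and "n = - int m \<Longrightarrow> (LINT w|lebesgue. indicator diskD w *\<^sub>R (z * cnj (f w) / (1 - cnj w * z)))
      = (LINT w|lborel. indicator (ball 0 1) w *\<^sub>R (z ^ Suc m * (cnj (f w) * cnj w ^ m)))"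
proof -
  have [measurable]: "f \<in> borel_measurable borel" using f by (rule borel_measurable_continuous_onI)
  have [measurable]: "(\<lambda>w. cnj (f w)) \<in> borel_measurable borel" "cnj \<in> borel_measurable borel"
    by (intro borel_measurable_continuous_onI continuous_intros f)+
  define h where "h = (\<lambda>w. (if cmod w < 1 then z else 0) * cnj (f w))"
  have [measurable]: "h \<in> borel_measurable borel" unfolding h_def by measurable
  let ?F = "\<lambda>w. indicator diskD w *\<^sub>R (z * cnj (f w) / (1 - cnj w * z))"
  obtain C where C: "\<And>w. w \<in> diskD \<Longrightarrow> cmod (f w) \<le> C" using continuous_bounded_on_diskD f by blast
  have F_borel: "?F \<in> borel_measurable borel" by measurable
  have "integrable lebesgue ?F"
    using cauchy_kernels_integrable(2)[OF continuous_measurable_lebesgue[OF f] _ z] C by blast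
  then have F: "integrable lborel ?F" using F_borel by (simp add: integrable_completion)
  have h_eq: "h w / (1 - cnj w * z) = ?F w" for w by (auto simp: h_def indicator_def diskD_def)
  have eq: "(LINT w|lebesgue. ?F w) = (LINT w|lborel. h w / (1 - cnj w * z))"
    unfolding h_eq using F_borel by (intro integral_completion) simp
  have h_mode: "rot_mode (- n - int k) (\<lambda>w. h w * (cnj w * z) ^ k)" for k
  proof -
    have "rot_mode (0 + - n + int k * (- 1 + 0)) (\<lambda>w. h w * (cnj w * z) ^ k)"
      unfolding h_def
      by (intro rot_mode_mult rot_mode_power rot_mode_cnj rot_mode_id rot_mode_const mode
          rot_mode_radial[of "\<lambda>r. if r < 1 then z else 0"])
    then show ?thesis by simp
  qed
  have h0: "(LINT w|lborel. h w * (cnj w * z) ^ k) = 0" if "- n - int k \<noteq> 0" for k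
    using that by (intro integral_rot_mode_eq_0[OF _ h_mode]) auto
  have q: "cmod (cnj w * z) < 1" if "h w \<noteq> 0" for w
  proof -
    have "cmod w < 1" using that by (auto simp: h_def split: if_splits)
    then have "cmod w * cmod z \<le> 1 * cmod z" by (intro mult_right_mono) auto
    then show ?thesis using z by (simp add: norm_mult diskD_def)
  qed
  have int: "integrable lborel (\<lambda>w. h w / (1 - cnj w * z))" unfolding h_eq by (rule F)
  show "(LINT w|lebesgue. ?F w) = 0" if "n > 0"
  proof -
    have "(LINT w|lborel. h w / (1 - cnj w * z)) = (LINT w|lborel. h w * (cnj w * z) ^ 0)"
      by (rule integral_geometric_series[OF _ _ int q h0]) (use that in auto)
    then show ?thesis using eq h0[of 0] that by simp
  qed
  show "(LINT w|lebesgue. ?F w) = (LINT w|lborel. indicator (ball 0 1) w *\<^sub>R (z ^ Suc m * (cnj (f w) * cnj w ^ m)))"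
    if "n = - int m"
  proof -
    have "(LINT w|lborel. h w / (1 - cnj w * z)) = (LINT w|lborel. h w * (cnj w * z) ^ m)"
      by (rule integral_geometric_series[OF _ _ int q h0]) (use that in auto)
    also have "\<dots> = (LINT w|lborel. indicator (ball 0 1) w *\<^sub>R (z ^ Suc m * (cnj (f w) * cnj w ^ m)))"
      by (intro Bochner_Integration.integral_cong) (auto simp: h_def indicator_def power_mult_distrib)
    finally show ?thesis using eq by simp
  qed
qed

lemma integral_indicator_Icc_derivative:
  fixes G g :: "real \<Rightarrow> complex"
  assumes "\<And>s. (G has_vector_derivative g s) (at s)" "continuous_on UNIV g" "a \<le> b"
  shows "(LINT s|lborel. indicator {a..b} s *\<^sub>R g s) = G b - G a"
  using assms by (intro integral_FTC_Icc)
    (auto intro: has_vector_derivative_at_within continuous_on_subset)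

text \<open>Only the annulus |z| < |w| < 1 contributes, and there p' is integrated from |z|^2 to 1.
  The result is the antiderivative that vanishes on the unit circle, the reflected kernel
  contributing 0 to a positive mode.\<close>

lemma cauchyP_mode_pos:
  fixes p p' :: "real \<Rightarrow> complex"
  assumes p: "\<And>s. (p has_vector_derivative p' s) (at s)" and p': "continuous_on UNIV p'" and z: "z \<in> diskD"
  shows "cauchyP (\<lambda>w. w ^ Suc m * p' ((cmod w)\<^sup>2)) z = z ^ m * (p ((cmod z)\<^sup>2) - p 1)"
proof -
  define f where "f = (\<lambda>w. w ^ Suc m * p' ((cmod w)\<^sup>2))"
  have [measurable]: "p' \<in> borel_measurable borel" using p' by (rule borel_measurable_continuous_onI)
  have f: "continuous_on UNIV f"
    unfolding f_def by (intro continuous_intros continuous_on_compose2[OF p']) auto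
  have mode: "rot_mode (1 + int m) f"
    using rot_mode_mult[OF rot_mode_power[OF rot_mode_id, of "Suc m"] rot_mode_radial[of "\<lambda>r. p' (r\<^sup>2)"]]
    by (simp add: f_def)
  obtain C where C: "\<And>w. w \<in> diskD \<Longrightarrow> cmod (f w) \<le> C" using continuous_bounded_on_diskD f by blast
  define H where "H s = (if (cmod z)\<^sup>2 < s then z ^ m * p' s else 0)" for s
  have [measurable]: "H \<in> borel_measurable borel" unfolding H_def by measurable
  have z1: "(cmod z)\<^sup>2 \<le> 1" using z by (auto simp: diskD_def power_le_one)
  have z0: "(cmod z)\<^sup>2 < s \<Longrightarrow> 0 \<le> s" for s by (smt (verit) zero_le_power2)
  have "(LINT w|lebesgue. indicator diskD w *\<^sub>R (f w / (w - z)))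
      = (LINT w|lborel. indicator (ball 0 1) w *\<^sub>R (if cmod z < cmod w then z ^ m * (f w * inverse w ^ Suc m) else 0))"
    by (rule cauchy_integral_mode(1)[OF f z mode refl])
  also have "\<dots> = (LINT w|lborel. indicator (ball (0::complex) 1) w *\<^sub>R H ((cmod w)\<^sup>2))"
  proof (rule Bochner_Integration.integral_cong[OF refl])
    fix w :: complex
    have "cmod z < cmod w \<longleftrightarrow> (cmod z)\<^sup>2 < (cmod w)\<^sup>2" by (meson norm_ge_zero power2_less_imp_less power_strict_mono zero_less_numeral)
    moreover have "f w * inverse w ^ Suc m = p' ((cmod w)\<^sup>2)" if "w \<noteq> 0"
      using that by (simp add: f_def power_inverse field_simps)
    ultimately show "indicator (ball 0 1) w *\<^sub>R (if cmod z < cmod w then z ^ m * (f w * inverse w ^ Suc m) else 0)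
      = indicator (ball 0 1) w *\<^sub>R H ((cmod w)\<^sup>2)"
      by (cases "w = 0") (auto simp: H_def simp del: power_Suc)
  qed
  also have "\<dots> = pi *\<^sub>R (LINT s|lborel. indicator {0..1} s *\<^sub>R H s)"
    using integral_radial[of H 1] by simp
  also have "(LINT s|lborel. indicator {0..1} s *\<^sub>R H s) = (LINT s|lborel. z ^ m * (indicator {(cmod z)\<^sup>2..1} s *\<^sub>R p' s))"
  proof (rule integral_cong_AE)
    show "AE s in lborel. indicator {0..1} s *\<^sub>R H s = z ^ m * (indicator {(cmod z)\<^sup>2..1} s *\<^sub>R p' s)"
      using AE_lborel_singleton[of "(cmod z)\<^sup>2"]
      by eventually_elim (auto simp: H_def indicator_def split: if_splits dest: z0)
  qed measurable
  also have "\<dots> = z ^ m * (p 1 - p ((cmod z)\<^sup>2))"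
    by (subst integral_mult_right_zero, subst integral_indicator_Icc_derivative[OF p p' z1]) (rule refl)
  finally have 1: "(LINT w|lebesgue. indicator diskD w *\<^sub>R (f w / (w - z))) = pi *\<^sub>R (z ^ m * (p 1 - p ((cmod z)\<^sup>2)))" .
  have 2: "(LINT w|lebesgue. indicator diskD w *\<^sub>R (z * cnj (f w) / (1 - cnj w * z))) = 0"
    by (rule reflected_integral_mode(1)[OF f z mode]) simp
  have "cauchyP f z = - ((1 / pi) *\<^sub>R (pi *\<^sub>R (z ^ m * (p 1 - p ((cmod z)\<^sup>2)))))"
    using cauchyP_eq[where C = C, OF continuous_measurable_lebesgue[OF f] _ z] C by (simp add: 1 2)
  then show ?thesis by (simp add: f_def algebra_simps)
qed

text \<open>The bracket is chosen so that s^m times it is the derivative of \<open>G\<close>, that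
  is s^(m+1) q(s). The Cauchy kernel integrates it over |w| < |z|. The reflected kernel integrates
  its conjugate over the whole disk and adds the holomorphic term that makes the result purely
  imaginary on the circle.\<close>

lemma cauchyP_mode_neg:
  fixes q q' :: "real \<Rightarrow> complex"
  assumes q: "\<And>s. (q has_vector_derivative q' s) (at s)" and q': "continuous_on UNIV q'" and z: "z \<in> diskD"
  shows "cauchyP (\<lambda>w. cnj w ^ m * (of_nat (Suc m) * q ((cmod w)\<^sup>2) + of_real ((cmod w)\<^sup>2) * q' ((cmod w)\<^sup>2))) z
    = cnj z ^ Suc m * q ((cmod z)\<^sup>2) - z ^ Suc m * cnj (q 1)"
proof -
  define g where "g s = of_nat (Suc m) * q s + of_real s * q' s" for s
  define f where "f = (\<lambda>w. cnj w ^ m * g ((cmod w)\<^sup>2))"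
  define G where "G s = of_real (s ^ Suc m) * q s" for s
  have qc: "continuous_on UNIV q"
    using q by (meson continuous_at_imp_continuous_on has_vector_derivative_continuous)
  have gc: "continuous_on UNIV g" unfolding g_def by (intro continuous_intros qc q')
  have [measurable]: "g \<in> borel_measurable borel" using gc by (rule borel_measurable_continuous_onI)
  have [measurable]: "(\<lambda>s. cnj (g s)) \<in> borel_measurable borel" "cnj \<in> borel_measurable borel"
    by (intro borel_measurable_continuous_onI continuous_intros gc)+
  have G: "(G has_vector_derivative of_real (s ^ m) * g s) (at s)" for s
  proof -
    have "((\<lambda>s. of_real (s ^ Suc m) :: complex) has_vector_derivative of_real (real (Suc m) * s ^ m)) (at s)"
      by (rule has_vector_derivative_of_real) (use DERIV_pow[of "Suc m" s] in simp)
    from has_vector_derivative_mult[OF this q[of s]] show ?thesis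
      unfolding G_def g_def by (simp add: algebra_simps)
  qed
  have G': "continuous_on UNIV (\<lambda>s. of_real (s ^ m) * g s)" by (intro continuous_intros gc)
  have f: "continuous_on UNIV f"
    unfolding f_def by (intro continuous_intros continuous_on_compose2[OF gc]) auto
  have mode: "rot_mode (- int m) f"
    using rot_mode_mult[OF rot_mode_power[OF rot_mode_cnj[OF rot_mode_id], of "m"] rot_mode_radial[of "\<lambda>r. g (r\<^sup>2)"]]
    by (simp add: f_def)
  obtain C where C: "\<And>w. w \<in> diskD \<Longrightarrow> cmod (f w) \<le> C" using continuous_bounded_on_diskD f by blast
  have abs2: "cnj w ^ m * w ^ m = of_real (((cmod w)\<^sup>2) ^ m)" for w
    unfolding power_mult_distrib[symmetric] of_real_power[of _ m] complex_norm_square by (simp add: mult.commute)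
  define H where "H s = (if s < (cmod z)\<^sup>2 then - (inverse z ^ Suc m * (of_real (s ^ m) * g s)) else 0)" for s
  have [measurable]: "H \<in> borel_measurable borel" unfolding H_def by measurable
  have z1: "(cmod z)\<^sup>2 \<le> 1" using z by (auto simp: diskD_def power_le_one)
  have "(LINT w|lebesgue. indicator diskD w *\<^sub>R (f w / (w - z)))
      = (LINT w|lborel. indicator (ball 0 1) w *\<^sub>R (if cmod w < cmod z then - (inverse z ^ Suc m * (f w * w ^ m)) else 0))"
    by (rule cauchy_integral_mode(2)[OF f z mode refl])
  also have "\<dots> = (LINT w|lborel. indicator (ball (0::complex) 1) w *\<^sub>R H ((cmod w)\<^sup>2))"
  proof (rule Bochner_Integration.integral_cong[OF refl])
    fix w :: complex
    have "cmod w < cmod z \<longleftrightarrow> (cmod w)\<^sup>2 < (cmod z)\<^sup>2" by (meson norm_ge_zero power2_less_imp_less power_strict_mono zero_less_numeral)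
    moreover have "f w * w ^ m = of_real (((cmod w)\<^sup>2) ^ m) * g ((cmod w)\<^sup>2)"
      using abs2[of w] by (simp add: f_def mult_ac)
    ultimately show "indicator (ball 0 1) w *\<^sub>R (if cmod w < cmod z then - (inverse z ^ Suc m * (f w * w ^ m)) else 0)
      = indicator (ball 0 1) w *\<^sub>R H ((cmod w)\<^sup>2)"
      by (simp only: H_def)
  qed
  also have "\<dots> = pi *\<^sub>R (LINT s|lborel. indicator {0..1} s *\<^sub>R H s)"
    using integral_radial[of H 1] by simp
  also have "(LINT s|lborel. indicator {0..1} s *\<^sub>R H s)
      = (LINT s|lborel. (- (inverse z ^ Suc m)) * (indicator {0..(cmod z)\<^sup>2} s *\<^sub>R (of_real (s ^ m) * g s)))"
  proof (rule integral_cong_AE)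
    show "AE s in lborel. indicator {0..1} s *\<^sub>R H s = (- (inverse z ^ Suc m)) * (indicator {0..(cmod z)\<^sup>2} s *\<^sub>R (of_real (s ^ m) * g s))"
      using AE_lborel_singleton[of "(cmod z)\<^sup>2"]
      by eventually_elim (use z1 in \<open>auto simp: H_def indicator_def split: if_splits\<close>)
  qed measurable
  also have "\<dots> = (- (inverse z ^ Suc m)) * (G ((cmod z)\<^sup>2) - G 0)"
    by (subst integral_mult_right_zero, subst integral_indicator_Icc_derivative[OF G G']) simp_all
  also have "\<dots> = - (cnj z ^ Suc m * q ((cmod z)\<^sup>2))"
  proof -
    have "inverse z ^ Suc m * of_real (((cmod z)\<^sup>2) ^ Suc m) = cnj z ^ Suc m"
    proof -
      \<comment> \<open>For z = 0 both sides are 0, so no case distinction is left in the main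
        identity.\<close>
      have "inverse z * (z * cnj z) = cnj z" by (cases "z = 0") auto
      then show ?thesis
        unfolding of_real_power[of _ "Suc m"] complex_norm_square power_mult_distrib[symmetric] by (simp only:)
    qed
    then have "(- (inverse z ^ Suc m)) * (G ((cmod z)\<^sup>2) - G 0) = - (cnj z ^ Suc m * q ((cmod z)\<^sup>2))"
      unfolding G_def by (metis (no_types, lifting) diff_zero mult.assoc mult_minus_left mult_zero_left of_real_0 power_0_Suc)
    then show ?thesis .
  qed
  finally have 1: "(LINT w|lebesgue. indicator diskD w *\<^sub>R (f w / (w - z))) = pi *\<^sub>R - (cnj z ^ Suc m * q ((cmod z)\<^sup>2))" .
  have "(LINT w|lebesgue. indicator diskD w *\<^sub>R (z * cnj (f w) / (1 - cnj w * z)))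
      = (LINT w|lborel. indicator (ball 0 1) w *\<^sub>R (z ^ Suc m * (cnj (f w) * cnj w ^ m)))"
    by (rule reflected_integral_mode(2)[OF f z mode refl])
  also have "\<dots> = (LINT w|lborel. indicator (ball 0 1) w *\<^sub>R (z ^ Suc m * cnj (of_real (((cmod w)\<^sup>2) ^ m) * g ((cmod w)\<^sup>2))))"
  proof (rule Bochner_Integration.integral_cong[OF refl])
    fix w :: complex
    have "cnj (f w) * cnj w ^ m = cnj (of_real (((cmod w)\<^sup>2) ^ m) * g ((cmod w)\<^sup>2))"
      unfolding abs2[symmetric] by (simp add: f_def mult_ac)
    then show "indicator (ball 0 1) w *\<^sub>R (z ^ Suc m * (cnj (f w) * cnj w ^ m))
      = indicator (ball 0 1) w *\<^sub>R (z ^ Suc m * cnj (of_real (((cmod w)\<^sup>2) ^ m) * g ((cmod w)\<^sup>2)))"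
      by (simp only:)
  qed
  also have "\<dots> = pi *\<^sub>R (LINT s|lborel. indicator {0..1} s *\<^sub>R (z ^ Suc m * cnj (of_real (s ^ m) * g s)))"
    using integral_radial[of "\<lambda>s. z ^ Suc m * cnj (of_real (s ^ m) * g s)" 1] by simp
  also have "(LINT s|lborel. indicator {0..1} s *\<^sub>R (z ^ Suc m * cnj (of_real (s ^ m) * g s)))
    = (LINT s|lborel. z ^ Suc m * cnj (indicator {0..1} s *\<^sub>R (of_real (s ^ m) * g s)))"
    by (intro Bochner_Integration.integral_cong) auto
  also have "\<dots> = z ^ Suc m * cnj (G 1 - G 0)"
    by (subst integral_mult_right_zero, subst integral_bounded_linear'[OF bounded_linear_cnj bounded_linear_cnj],
        simp, subst integral_indicator_Icc_derivative[OF G G']) simp_all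
  finally have 2: "(LINT w|lebesgue. indicator diskD w *\<^sub>R (z * cnj (f w) / (1 - cnj w * z))) = pi *\<^sub>R (z ^ Suc m * cnj (q 1))"
    by (simp add: G_def)
  have "cauchyP f z = - ((1 / pi) *\<^sub>R (pi *\<^sub>R - (cnj z ^ Suc m * q ((cmod z)\<^sup>2)) + pi *\<^sub>R (z ^ Suc m * cnj (q 1))))"
    using cauchyP_eq[where C = C, OF continuous_measurable_lebesgue[OF f] _ z] C by (simp add: 1 2)
  then show ?thesis unfolding f_def g_def by (simp add: scaleR_add_right scaleR_diff_right)
qed

section \<open>Energy of angular modes\<close>

text \<open>If \<open>p'\<close> and \<open>q'\<close> are the derivatives of \<open>p\<close> and \<open>q\<close>, then \<open>mode_phi\<close> is the derivative of \<open>mode_u\<close> with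
  respect to \<open>cnj w\<close>. The condition on \<open>p 1\<close> in \<open>mode_profile\<close> makes \<open>mode_u\<close> purely imaginary on the unit circle.\<close>
definition mode_u :: "nat \<Rightarrow> (real \<Rightarrow> complex) \<Rightarrow> (real \<Rightarrow> complex) \<Rightarrow> complex \<Rightarrow> complex" where
  "mode_u m p q w = w ^ m * p ((cmod w)\<^sup>2) + cnj w ^ m * q ((cmod w)\<^sup>2)"

definition mode_phi :: "nat \<Rightarrow> (real \<Rightarrow> complex) \<Rightarrow> (real \<Rightarrow> complex) \<Rightarrow> (real \<Rightarrow> complex) \<Rightarrow> complex \<Rightarrow> complex" where
  "mode_phi m p' q q' w = w ^ Suc m * p' ((cmod w)\<^sup>2)
    + cnj w ^ (m - 1) * (of_nat m * q ((cmod w)\<^sup>2) + of_real ((cmod w)\<^sup>2) * q' ((cmod w)\<^sup>2))"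

definition mode_profile :: "nat \<Rightarrow> (real \<Rightarrow> complex) \<Rightarrow> (real \<Rightarrow> complex) \<Rightarrow> (real \<Rightarrow> complex) \<Rightarrow> (real \<Rightarrow> complex) \<Rightarrow> bool" where
  "mode_profile m p p' q q' \<longleftrightarrow>
    (\<forall>s. (p has_vector_derivative p' s) (at s)) \<and> (\<forall>s. (q has_vector_derivative q' s) (at s)) \<and>
    continuous_on UNIV p' \<and> continuous_on UNIV q' \<and> p 1 = - cnj (q 1) \<and>
    (m = 0 \<longrightarrow> q = (\<lambda>_. 0) \<and> q' = (\<lambda>_. 0))"

lemma mode_profile_continuous:
  assumes "mode_profile m p p' q q'"
  shows "continuous_on UNIV p" "continuous_on UNIV q" "continuous_on UNIV p'" "continuous_on UNIV q'"
  using assms unfolding mode_profile_def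
  by (meson continuous_at_imp_continuous_on has_vector_derivative_continuous)+

lemma continuous_on_radial:
  assumes "continuous_on UNIV g"
  shows "continuous_on UNIV (\<lambda>w::complex. g ((cmod w)\<^sup>2))"
  by (intro continuous_on_compose2[OF assms] continuous_intros) auto

lemma continuous_mode_phi:
  assumes "mode_profile m p p' q q'"
  shows "continuous_on UNIV (mode_phi m p' q q')"
  unfolding mode_phi_def[abs_def]
  by (intro continuous_intros continuous_on_radial mode_profile_continuous[OF assms])

lemma continuous_mode_u:
  assumes "mode_profile m p p' q q'"
  shows "continuous_on UNIV (mode_u m p q)"
  unfolding mode_u_def[abs_def]
  by (intro continuous_intros continuous_on_radial mode_profile_continuous[OF assms])

text \<open>The two transforms leave the extra terms - z^m p(1) and - z^m cnj(q(1)); the condition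
  on \<open>p 1\<close> makes them cancel. It thus fixes the constant of integration in p.\<close>

lemma cauchyP_mode:
  assumes prof: "mode_profile m p p' q q'" and z: "z \<in> diskD"
  shows "cauchyP (mode_phi m p' q q') z = mode_u m p q z"
proof -
  note p = prof[unfolded mode_profile_def]
  note c = mode_profile_continuous[OF prof]
  show ?thesis
  proof (cases m)
    case 0
    have "cauchyP (mode_phi m p' q q') z = cauchyP (\<lambda>w. w ^ Suc 0 * p' ((cmod w)\<^sup>2)) z"
      using 0 p by (simp add: mode_phi_def[abs_def])
    also have "\<dots> = z ^ 0 * (p ((cmod z)\<^sup>2) - p 1)"
      using p z by (intro cauchyP_mode_pos) auto
    finally show ?thesis using 0 p by (simp add: mode_u_def)
  next
    case (Suc k)
    have "cauchyP (mode_phi m p' q q') z = cauchyP (\<lambda>w. w ^ Suc m * p' ((cmod w)\<^sup>2)) z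
      + cauchyP (\<lambda>w. cnj w ^ k * (of_nat (Suc k) * q ((cmod w)\<^sup>2) + of_real ((cmod w)\<^sup>2) * q' ((cmod w)\<^sup>2))) z"
      unfolding mode_phi_def[abs_def] Suc diff_Suc_1
      by (intro cauchyP_add z continuous_intros continuous_on_radial c)
    also have "cauchyP (\<lambda>w. w ^ Suc m * p' ((cmod w)\<^sup>2)) z = z ^ m * (p ((cmod z)\<^sup>2) - p 1)"
      using p z by (intro cauchyP_mode_pos) auto
    also have "cauchyP (\<lambda>w. cnj w ^ k * (of_nat (Suc k) * q ((cmod w)\<^sup>2) + of_real ((cmod w)\<^sup>2) * q' ((cmod w)\<^sup>2))) z
      = cnj z ^ Suc k * q ((cmod z)\<^sup>2) - z ^ Suc k * cnj (q 1)"
      using p z by (intro cauchyP_mode_neg) auto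
    finally show ?thesis using Suc p by (simp add: mode_u_def algebra_simps)
  qed
qed

definition disk_energy :: "(complex \<Rightarrow> complex) \<Rightarrow> real" where
  "disk_energy f = (1 / pi) * (LINT w|lborel. indicator (ball 0 1) w * (cmod (f w))\<^sup>2)"

lemma integrable_ball_continuous:
  fixes f :: "complex \<Rightarrow> 'a::{banach, second_countable_topology}"
  assumes "continuous_on UNIV f"
  shows "integrable lborel (\<lambda>w. indicator (ball 0 1) w *\<^sub>R f w)"
proof -
  have "integrable lborel (\<lambda>w. indicator (cball 0 1) w *\<^sub>R f w)"
    using borel_integrable_compact[of "cball 0 1" f] assms
    by (auto simp: indicator_scaleR_eq_if intro: continuous_on_subset)
  from integrable_mult_indicator[OF _ this, of "ball 0 1"]
  show ?thesis by (rule Bochner_Integration.integrable_cong[THEN iffD1, rotated 2]) (auto simp: indicator_def)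
qed

lemma L2sq_eq_disk_energy:
  assumes "continuous_on UNIV f"
  shows "L2sq f = ennreal (disk_energy f)"
proof -
  have i: "integrable lborel (\<lambda>w. indicator (ball 0 1) w * (cmod (f w))\<^sup>2)"
    using integrable_ball_continuous[of "\<lambda>w. (cmod (f w))\<^sup>2"] assms by (simp add: continuous_intros)
  have "(\<integral>\<^sup>+ z. indicator diskD z * ennreal ((cmod (f z))\<^sup>2) \<partial>lebesgue)
    = (\<integral>\<^sup>+ z. ennreal (indicator (ball 0 1) z * (cmod (f z))\<^sup>2) \<partial>lborel)"
    unfolding nn_integral_completion
    by (intro nn_integral_cong) (auto simp: diskD_eq_ball indicator_def)
  also have "\<dots> = ennreal (LINT w|lborel. indicator (ball 0 1) w * (cmod (f w))\<^sup>2)"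
    by (rule nn_integral_eq_integral[OF i]) auto
  finally show ?thesis unfolding L2sq_def disk_energy_def by (subst ennreal_mult') simp_all
qed

text \<open>A product of one mode with the conjugate of another has index m - n, nonzero, hence
  integral 0. The indices are chosen per pair so that a vanishing summand may take any index that
  suits its partner.\<close>

lemma disk_energy_sum_orthogonal:
  fixes f :: "'i \<Rightarrow> complex \<Rightarrow> complex"
  assumes "finite I" and c: "\<And>i. i \<in> I \<Longrightarrow> continuous_on UNIV (f i)"
    and orth: "\<And>i j. i \<in> I \<Longrightarrow> j \<in> I \<Longrightarrow> i \<noteq> j \<Longrightarrow> \<exists>m n. rot_mode m (f i) \<and> rot_mode n (f j) \<and> m \<noteq> n"
  shows "disk_energy (\<lambda>w. \<Sum>i\<in>I. f i w) = (\<Sum>i\<in>I. disk_energy (f i))"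
proof -
  have int: "integrable lborel (\<lambda>w. indicator (ball 0 1) w *\<^sub>R (f i w * cnj (f j w)))" if "i \<in> I" "j \<in> I" for i j
    using that c by (intro integrable_ball_continuous continuous_intros)
  have orth0: "(LINT w|lborel. indicator (ball 0 1) w *\<^sub>R (f i w * cnj (f j w))) = 0"
    if ij: "i \<in> I" "j \<in> I" "i \<noteq> j" for i j
  proof -
    from orth[OF ij] obtain m n where mn: "rot_mode m (f i)" "rot_mode n (f j)" "m \<noteq> n" by blast
    have [measurable]: "f i \<in> borel_measurable borel" "(\<lambda>w. cnj (f j w)) \<in> borel_measurable borel"
      using ij by (auto intro!: borel_measurable_continuous_onI continuous_intros c)
    have "rot_mode (0 + (m + - n)) (\<lambda>w. complex_of_real (if cmod w < 1 then 1 else 0) * (f i w * cnj (f j w)))"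
      by (intro rot_mode_mult rot_mode_cnj mn rot_mode_radial[of "\<lambda>r. complex_of_real (if r < 1 then 1 else 0)"])
    moreover have "(\<lambda>w. complex_of_real (if cmod w < 1 then 1 else 0) * (f i w * cnj (f j w)))
      = (\<lambda>w. indicator (ball 0 1) w *\<^sub>R (f i w * cnj (f j w)))"
      by (auto simp: indicator_def)
    moreover have "(\<lambda>w. indicator (ball 0 1) w *\<^sub>R (f i w * cnj (f j w))) \<in> borel_measurable borel"
      by (intro borel_measurable_scaleR borel_measurable_indicator borel_measurable_times) auto
    ultimately show ?thesis using mn(3)
      by (intro integral_rot_mode_eq_0[where n = "m - n"]) auto
  qed
  have sq: "complex_of_real (LINT w|lborel. indicator (ball 0 1) w * (cmod (g w))\<^sup>2)
      = (LINT w|lborel. indicator (ball 0 1) w *\<^sub>R (g w * cnj (g w)))" for g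
    unfolding integral_complex_of_real[symmetric]
    by (intro Bochner_Integration.integral_cong) (auto simp: indicator_def complex_norm_square simp flip: of_real_power)
  have "complex_of_real (LINT w|lborel. indicator (ball 0 1) w * (cmod (\<Sum>i\<in>I. f i w))\<^sup>2)
      = (LINT w|lborel. (\<Sum>i\<in>I. \<Sum>j\<in>I. indicator (ball 0 1) w *\<^sub>R (f i w * cnj (f j w))))"
    unfolding sq by (simp add: cnj_sum sum_product scaleR_sum_right)
  also have "\<dots> = (\<Sum>i\<in>I. \<Sum>j\<in>I. LINT w|lborel. indicator (ball 0 1) w *\<^sub>R (f i w * cnj (f j w)))"
    using int by (simp add: Bochner_Integration.integral_sum Bochner_Integration.integrable_sum)
  also have "\<dots> = (\<Sum>i\<in>I. \<Sum>j\<in>I. if j = i then LINT w|lborel. indicator (ball 0 1) w *\<^sub>R (f i w * cnj (f i w)) else 0)"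
    using orth0 by (intro sum.cong) auto
  also have "\<dots> = (\<Sum>i\<in>I. LINT w|lborel. indicator (ball 0 1) w *\<^sub>R (f i w * cnj (f i w)))"
    using assms(1) by simp
  also have "\<dots> = complex_of_real (\<Sum>i\<in>I. LINT w|lborel. indicator (ball 0 1) w * (cmod (f i w))\<^sup>2)"
    by (simp only: sq of_real_sum)
  finally show ?thesis
    unfolding of_real_eq_iff disk_energy_def by (simp add: sum_distrib_left)
qed

lemma disk_energy_radial:
  fixes g :: "real \<Rightarrow> complex"
  assumes "continuous_on UNIV g" and "\<And>w. cmod (e w) = cmod w ^ k"
  shows "disk_energy (\<lambda>w. e w * g ((cmod w)\<^sup>2)) = integral {0..1} (\<lambda>s. s ^ k * (cmod (g s))\<^sup>2)"
proof -
  define h where "h s = s ^ k * (cmod (g s))\<^sup>2" for s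
  have h: "continuous_on UNIV h" unfolding h_def by (intro continuous_intros assms)
  then have [measurable]: "h \<in> borel_measurable borel" by (rule borel_measurable_continuous_onI)
  have "(cmod (e w * g ((cmod w)\<^sup>2)))\<^sup>2 = h ((cmod w)\<^sup>2)" for w
    by (simp add: h_def norm_mult assms(2) power_mult_distrib mult.commute flip: power_mult)
  then have "disk_energy (\<lambda>w. e w * g ((cmod w)\<^sup>2)) = (1 / pi) * (LINT w|lborel. indicator (ball (0::complex) 1) w *\<^sub>R h ((cmod w)\<^sup>2))"
    unfolding disk_energy_def by simp
  also have "\<dots> = (LINT s|lborel. indicator {0..1} s *\<^sub>R h s)"
    using integral_radial[of h 1] by simp
  also have "\<dots> = integral {0..1} h"
    using set_borel_integral_eq_integral(2)[of "{0..1}" h] borel_integrable_atLeastAtMost'[of 0 1 h] h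
    by (simp add: set_lebesgue_integral_def continuous_on_subset)
  finally show ?thesis by (simp add: h_def[abs_def])
qed

lemma sum_Times_bool: "finite I \<Longrightarrow> (\<Sum>i\<in>I \<times> UNIV. F i) = (\<Sum>m\<in>I. F (m, True) + F (m, False))"
  for F :: "'a \<times> bool \<Rightarrow> 'b::comm_monoid_add"
  by (simp add: sum.cartesian_product' UNIV_bool add.commute)

lemma rot_mode_zero: "rot_mode n (\<lambda>w. 0)"
  by (simp add: rot_mode_def)

text \<open>The flag in the index set \<open>I \<times> UNIV\<close> separates the w^m part from the
  \<open>cnj w\<close> part. Their rotation indices m and -m collide only at m = 0, where the
  profile forces q = 0.\<close>

lemma disk_energy_mode_u:
  assumes I: "finite I" and prof: "\<And>m. m \<in> I \<Longrightarrow> mode_profile m (p m) (p' m) (q m) (q' m)"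
  shows "disk_energy (\<lambda>w. \<Sum>m\<in>I. mode_u m (p m) (q m) w)
    = (\<Sum>m\<in>I. integral {0..1} (\<lambda>s. s ^ m * (cmod (p m s))\<^sup>2) + integral {0..1} (\<lambda>s. s ^ m * (cmod (q m s))\<^sup>2))"
proof -
  define F where "F = (\<lambda>(m, b) w. (if b then w ^ m else cnj w ^ m) * (if b then p m else q m) ((cmod w)\<^sup>2))"
  define \<nu> where "\<nu> = (\<lambda>(m, b). if b then int m else - int m)"
  note c = mode_profile_continuous[OF prof]
  have mode: "rot_mode (\<nu> i) (F i)" for i
  proof (cases i)
    case (Pair m b)
    show ?thesis
    proof (cases b)
      case True
      have "rot_mode (int m * 1 + 0) (F i)" unfolding Pair F_def prod.case using True
        by (simp only: if_True) (intro rot_mode_mult rot_mode_power rot_mode_id rot_mode_radial[of "\<lambda>r. p m (r\<^sup>2)"])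
      then show ?thesis by (simp add: \<nu>_def Pair True)
    next
      case False
      have "rot_mode (int m * - 1 + 0) (F i)" unfolding Pair F_def prod.case using False
        by (simp only: if_False) (intro rot_mode_mult rot_mode_power rot_mode_cnj rot_mode_id rot_mode_radial[of "\<lambda>r. q m (r\<^sup>2)"])
      then show ?thesis using False Pair by (simp add: \<nu>_def)
    qed
  qed
  have "disk_energy (\<lambda>w. \<Sum>i\<in>I \<times> UNIV. F i w) = (\<Sum>i\<in>I \<times> UNIV. disk_energy (F i))"
  proof (rule disk_energy_sum_orthogonal)
    show "continuous_on UNIV (F i)" if "i \<in> I \<times> UNIV" for i
      using that by (cases i; cases "snd i") (auto simp: F_def intro!: continuous_intros continuous_on_radial c)
    show "\<exists>m n. rot_mode m (F i) \<and> rot_mode n (F j) \<and> m \<noteq> n" if "i \<in> I \<times> UNIV" "j \<in> I \<times> UNIV" "i \<noteq> j" for i j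
    proof (cases "\<nu> i = \<nu> j")
      case False then show ?thesis using mode by blast
    next
      case True
      have "F i = (\<lambda>_. 0) \<or> F j = (\<lambda>_. 0)"
      proof (cases i; cases j)
        fix m b m' b' assume ij: "i = (m, b)" "j = (m', b')"
        have "(\<not> b \<and> m = 0) \<or> (\<not> b' \<and> m' = 0)"
          using True that(3) unfolding ij \<nu>_def by (cases b; cases b') auto
        moreover have "q 0 = (\<lambda>_. 0)" if "0 \<in> I"
          using prof[OF that] by (simp add: mode_profile_def)
        ultimately show ?thesis using that unfolding ij F_def by auto
      qed
      \<comment> \<open>The zero function can be given an index different from that of the other
        summand.\<close>
      then show ?thesis
        using mode rot_mode_zero by (metis add_cancel_left_right zero_neq_one)
    qed
  qed (use I in auto)
  moreover have "(\<lambda>w. \<Sum>i\<in>I \<times> UNIV. F i w) = (\<lambda>w. \<Sum>m\<in>I. mode_u m (p m) (q m) w)"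
    using I by (auto simp: sum_Times_bool F_def mode_u_def)
  moreover have "(\<Sum>i\<in>I \<times> UNIV. disk_energy (F i)) = (\<Sum>m\<in>I. integral {0..1} (\<lambda>s. s ^ m * (cmod (p m s))\<^sup>2) + integral {0..1} (\<lambda>s. s ^ m * (cmod (q m s))\<^sup>2))"
    unfolding sum_Times_bool[OF I] F_def using c
    by (intro sum.cong arg_cong2[where f="(+)"]) (auto intro!: disk_energy_radial simp: norm_power)
  ultimately show ?thesis by simp
qed

text \<open>The indices are m + 1 and -(m - 1). Truncated subtraction gives index 0 to the second
  part of both m = 0 and m = 1, and again the part with m = 0 vanishes.\<close>

lemma disk_energy_mode_phi:
  assumes I: "finite I" and prof: "\<And>m. m \<in> I \<Longrightarrow> mode_profile m (p m) (p' m) (q m) (q' m)"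
  shows "disk_energy (\<lambda>w. \<Sum>m\<in>I. mode_phi m (p' m) (q m) (q' m) w)
    = (\<Sum>m\<in>I. integral {0..1} (\<lambda>s. s ^ (m + 1) * (cmod (p' m s))\<^sup>2)
      + integral {0..1} (\<lambda>s. s ^ (m - 1) * (cmod (of_nat m * q m s + of_real s * q' m s))\<^sup>2))"
proof -
  define g where "g = (\<lambda>m s. of_nat m * q m s + of_real s * q' m s)"
  define F where "F = (\<lambda>(m, b) w. (if b then w ^ (m + 1) else cnj w ^ (m - 1)) * (if b then p' m else g m) ((cmod w)\<^sup>2))"
  define \<nu> where "\<nu> = (\<lambda>(m, b). if b then int m + 1 else - int (m - 1))"
  note c = mode_profile_continuous[OF prof]
  have cg: "continuous_on UNIV (g m)" if "m \<in> I" for m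
    unfolding g_def by (intro continuous_intros c[OF that])
  have g0: "g 0 = (\<lambda>_. 0)" if "0 \<in> I"
    using prof[OF that] by (auto simp: g_def mode_profile_def)
  have mode: "rot_mode (\<nu> i) (F i)" for i
  proof (cases i)
    case (Pair m b)
    show ?thesis
    proof (cases b)
      case True
      have "rot_mode (int (m + 1) * 1 + 0) (F i)" unfolding Pair F_def prod.case using True
        by (simp only: if_True) (intro rot_mode_mult rot_mode_power rot_mode_id rot_mode_radial[of "\<lambda>r. p' m (r\<^sup>2)"])
      then show ?thesis by (simp add: \<nu>_def Pair True add.commute)
    next
      case False
      have "rot_mode (int (m - 1) * - 1 + 0) (F i)" unfolding Pair F_def prod.case using False
        by (simp only: if_False) (intro rot_mode_mult rot_mode_power rot_mode_cnj rot_mode_id rot_mode_radial[of "\<lambda>r. g m (r\<^sup>2)"])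
      then show ?thesis using False Pair by (simp add: \<nu>_def)
    qed
  qed
  have "disk_energy (\<lambda>w. \<Sum>i\<in>I \<times> UNIV. F i w) = (\<Sum>i\<in>I \<times> UNIV. disk_energy (F i))"
  proof (rule disk_energy_sum_orthogonal)
    show "continuous_on UNIV (F i)" if "i \<in> I \<times> UNIV" for i
      using that by (cases i; cases "snd i") (auto simp: F_def intro!: continuous_intros continuous_on_radial c cg)
    show "\<exists>m n. rot_mode m (F i) \<and> rot_mode n (F j) \<and> m \<noteq> n" if "i \<in> I \<times> UNIV" "j \<in> I \<times> UNIV" "i \<noteq> j" for i j
    proof (cases "\<nu> i = \<nu> j")
      case False then show ?thesis using mode by blast
    next
      case True
      have "F i = (\<lambda>_. 0) \<or> F j = (\<lambda>_. 0)"
      proof (cases i; cases j)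
        fix m b m' b' assume ij: "i = (m, b)" "j = (m', b')"
        have "(\<not> b \<and> m = 0) \<or> (\<not> b' \<and> m' = 0)"
          using True that(3) unfolding ij \<nu>_def by (cases b; cases b'; cases m; cases m') auto
        then show ?thesis using that g0 unfolding ij F_def by auto
      qed
      then show ?thesis
        using mode rot_mode_zero by (metis add_cancel_left_right zero_neq_one)
    qed
  qed (use I in auto)
  moreover have "(\<lambda>w. \<Sum>i\<in>I \<times> UNIV. F i w) = (\<lambda>w. \<Sum>m\<in>I. mode_phi m (p' m) (q m) (q' m) w)"
    using I by (auto simp: sum_Times_bool F_def mode_phi_def g_def)
  moreover have "(\<Sum>i\<in>I \<times> UNIV. disk_energy (F i)) = (\<Sum>m\<in>I. integral {0..1} (\<lambda>s. s ^ (m + 1) * (cmod (p' m s))\<^sup>2)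
      + integral {0..1} (\<lambda>s. s ^ (m - 1) * (cmod (g m s))\<^sup>2))"
    unfolding sum_Times_bool[OF I] F_def prod.case if_True if_False using c cg
    by (intro sum.cong arg_cong2[where f="(+)"] refl disk_energy_radial) (auto simp only: norm_power complex_mod_cnj)
  ultimately show ?thesis by (simp add: g_def)
qed

section \<open>Sharp inequality for polynomials\<close>

text \<open>Expanding the square shows that the integrands differ by m times the derivative of s^m
  |q|^2. This is the source of the positive boundary term.\<close>

lemma integral_mode_neg:
  fixes q q' :: "real \<Rightarrow> complex"
  assumes q: "\<And>s. (q has_vector_derivative q' s) (at s)" and q': "continuous_on UNIV q'" and m: "0 < m"
  shows "integral {0..1} (\<lambda>s. s ^ (m - 1) * (cmod (of_nat m * q s + of_real s * q' s))\<^sup>2)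
    = integral {0..1} (\<lambda>s. s ^ (m + 1) * (cmod (q' s))\<^sup>2) + real m * (cmod (q 1))\<^sup>2"
proof -
  define N where "N s = (cmod (q s))\<^sup>2" for s
  define N' where "N' s = 2 * (q s \<bullet> q' s)" for s
  define D where "D s = real m * s ^ (m - 1) * N s + s ^ m * N' s" for s
  have qc: "continuous_on UNIV q"
    using q by (meson continuous_at_imp_continuous_on has_vector_derivative_continuous)
  have N: "(N has_real_derivative N' s) (at s)" for s
    unfolding N_def N'_def power2_norm_eq_inner has_real_derivative_iff_has_vector_derivative
    using bounded_bilinear.has_vector_derivative[OF bounded_bilinear_inner q q, of s] by (simp add: inner_commute)
  have "(D has_integral 1 ^ m * N 1 - 0 ^ m * N 0) {0..1}"
  proof (rule fundamental_theorem_of_calculus)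
    fix s :: real
    have "((\<lambda>s. s ^ m * N s) has_real_derivative D s) (at s)"
      unfolding D_def by (auto intro!: derivative_eq_intros N)
    then show "((\<lambda>s. s ^ m * N s) has_vector_derivative D s) (at s within {0..1})"
      by (simp add: has_real_derivative_iff_has_vector_derivative has_vector_derivative_at_within)
  qed simp
  then have D: "(D has_integral (cmod (q 1))\<^sup>2) {0..1}" using m by (simp add: N_def zero_power)
  have "((\<lambda>s. s ^ (m + 1) * (cmod (q' s))\<^sup>2) has_integral integral {0..1} (\<lambda>s. s ^ (m + 1) * (cmod (q' s))\<^sup>2)) {0..1}"
    by (intro integrable_integral integrable_continuous_real continuous_intros continuous_on_subset[OF q']) auto
  from has_integral_add[OF this has_integral_mult_right[OF D, of "real m"]]
  have "((\<lambda>s. s ^ (m + 1) * (cmod (q' s))\<^sup>2 + real m * D s) has_integral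
    integral {0..1} (\<lambda>s. s ^ (m + 1) * (cmod (q' s))\<^sup>2) + real m * (cmod (q 1))\<^sup>2) {0..1}" .
  moreover have "s ^ (m + 1) * (cmod (q' s))\<^sup>2 + real m * D s
      = s ^ (m - 1) * (cmod (of_nat m * q s + of_real s * q' s))\<^sup>2" for s
  proof -
    have "of_nat m * q s + of_real s * q' s = real m *\<^sub>R q s + s *\<^sub>R q' s"
      by (simp add: scaleR_conv_of_real)
    then have "(cmod (of_nat m * q s + of_real s * q' s))\<^sup>2
      = s\<^sup>2 * (cmod (q' s))\<^sup>2 + real m * s * N' s + (real m)\<^sup>2 * N s"
      unfolding N_def N'_def power2_norm_eq_inner
      by (simp add: inner_add_left inner_add_right inner_commute power2_eq_square algebra_simps)
    moreover have "s ^ (m + 1) = s ^ (m - 1) * s\<^sup>2" "s ^ m = s ^ (m - 1) * s"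
      using m by (cases m; simp add: power2_eq_square)+
    ultimately show ?thesis by (simp add: D_def power2_eq_square algebra_simps)
  qed
  ultimately show ?thesis by (simp add: integral_unique)
qed

context neumann
begin

text \<open>For m >= 1 the inequalities for p and q each lose (m/2) |q(1)|^2 at the boundary, as
  |p(1)| = |q(1)|, and \<open>integral_mode_neg\<close> returns m |q(1)|^2.\<close>

lemma mode_energy_inequality:
  assumes prof: "mode_profile m p p' q q'"
  shows "l * (integral {0..1} (\<lambda>s. s ^ m * (cmod (p s))\<^sup>2) + integral {0..1} (\<lambda>s. s ^ m * (cmod (q s))\<^sup>2))
    \<le> integral {0..1} (\<lambda>s. s ^ (m + 1) * (cmod (p' s))\<^sup>2)
      + integral {0..1} (\<lambda>s. s ^ (m - 1) * (cmod (of_nat m * q s + of_real s * q' s))\<^sup>2)"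
proof -
  note P = prof[unfolded mode_profile_def]
  note c = mode_profile_continuous[OF prof]
  have split: "integral {0..1} (\<lambda>s. s ^ (m + 1) * (cmod (g' s))\<^sup>2 - l * (s ^ m * (cmod (g s))\<^sup>2))
    = integral {0..1} (\<lambda>s. s ^ (m + 1) * (cmod (g' s))\<^sup>2) - l * integral {0..1} (\<lambda>s. s ^ m * (cmod (g s))\<^sup>2)"
    if "continuous_on UNIV g" "continuous_on UNIV g'" for g g' :: "real \<Rightarrow> complex"
    using that by (subst integral_diff)
      (auto intro!: integrable_continuous_real continuous_intros continuous_on_subset[OF that(1)] continuous_on_subset[OF that(2)])
  show ?thesis
  proof (cases "m = 0")
    case True
    then have "p 1 = 0" "q = (\<lambda>_. 0)" "q' = (\<lambda>_. 0)" using P by auto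
    moreover have "0 \<le> integral {0..1} (\<lambda>s. s ^ (0 + 1) * (cmod (p' s))\<^sup>2 - l * (s ^ 0 * (cmod (p s))\<^sup>2))"
      using P \<open>p 1 = 0\<close> l_le by (intro mode_inequality_0) (auto intro: continuous_on_subset)
    ultimately show ?thesis using True split[OF c(1) c(3)] by simp
  next
    case False
    have "- (real m / 2) * (cmod (p 1))\<^sup>2 \<le> integral {0..1} (\<lambda>s. s ^ (m + 1) * (cmod (p' s))\<^sup>2 - l * (s ^ m * (cmod (p s))\<^sup>2))"
      using P False by (intro mode_inequality_pos) (auto intro: continuous_on_subset)
    moreover have "- (real m / 2) * (cmod (q 1))\<^sup>2 \<le> integral {0..1} (\<lambda>s. s ^ (m + 1) * (cmod (q' s))\<^sup>2 - l * (s ^ m * (cmod (q s))\<^sup>2))"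
      using P False by (intro mode_inequality_pos) (auto intro: continuous_on_subset)
    moreover have "cmod (p 1) = cmod (q 1)" using P by simp
    moreover have "integral {0..1} (\<lambda>s. s ^ (m - 1) * (cmod (of_nat m * q s + of_real s * q' s))\<^sup>2)
      = integral {0..1} (\<lambda>s. s ^ (m + 1) * (cmod (q' s))\<^sup>2) + real m * (cmod (q 1))\<^sup>2"
      using P False by (intro integral_mode_neg) auto
    ultimately show ?thesis using split[OF c(1) c(3)] split[OF c(2) c(4)] by (simp add: distrib_left)
  qed
qed

text \<open>Here \<open>mode_u\<close> is (z - cnj z) b(|z|^2) = 2 i Im(z) b(|z|^2), an imaginary
  multiple of a first Neumann eigenfunction of the disk.\<close>

lemma extremal_profile:
  "mode_profile 1 (\<lambda>s. of_real (b s)) (\<lambda>s. of_real (b' s)) (\<lambda>s. - of_real (b s)) (\<lambda>s. - of_real (b' s))"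
proof -
  have "continuous_on UNIV b'"
    using b' by (meson DERIV_continuous continuous_at_imp_continuous_on)
  then show ?thesis
    unfolding mode_profile_def
    by (auto intro!: has_vector_derivative_of_real has_vector_derivative_minus b continuous_intros)
qed

lemma extremal_solution_energy:
  "disk_energy (mode_u 1 (\<lambda>s. of_real (b s)) (\<lambda>s. - of_real (b s))) = 2 * integral {0..1} (\<lambda>s. s * (b s)\<^sup>2)"
  using disk_energy_mode_u[of "{1}" "\<lambda>_ s. of_real (b s)" "\<lambda>_ s. of_real (b' s)" "\<lambda>_ s. - of_real (b s)" "\<lambda>_ s. - of_real (b' s)"] extremal_profile
  by simp

text \<open>By the differential equation s^2 b'^2 - l s b^2 is the derivative of s^2 b' b. Its value
  -b(1)^2 / 2 at 1, taken once for p and once for q, cancels the boundary term b(1)^2.\<close>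

lemma extremal_energy:
  "disk_energy (mode_phi 1 (\<lambda>s. of_real (b' s)) (\<lambda>s. - of_real (b s)) (\<lambda>s. - of_real (b' s)))
    = l * disk_energy (mode_u 1 (\<lambda>s. of_real (b s)) (\<lambda>s. - of_real (b s)))"
proof -
  note P = extremal_profile[unfolded mode_profile_def]
  have bc: "continuous_on {0..1} b" "continuous_on {0..1} b'"
    using b b' by (meson DERIV_continuous continuous_at_imp_continuous_on)+
  have \<phi>: "disk_energy (mode_phi 1 (\<lambda>s. of_real (b' s)) (\<lambda>s. - of_real (b s)) (\<lambda>s. - of_real (b' s)))
    = 2 * integral {0..1} (\<lambda>s. s\<^sup>2 * (b' s)\<^sup>2) + (b 1)\<^sup>2"
    using disk_energy_mode_phi[of "{1}" "\<lambda>_ s. of_real (b s)" "\<lambda>_ s. of_real (b' s)" "\<lambda>_ s. - of_real (b s)" "\<lambda>_ s. - of_real (b' s)"] extremal_profile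
      integral_mode_neg[of "\<lambda>s. - of_real (b s)" "\<lambda>s. - of_real (b' s)" 1] P
    by (simp add: numeral_2_eq_2)
  have "((\<lambda>s. s\<^sup>2 * (b' s)\<^sup>2 - l * (s * (b s)\<^sup>2)) has_integral 1\<^sup>2 * b' 1 * b 1 - 0\<^sup>2 * b' 0 * b 0) {0..1}"
  proof (rule fundamental_theorem_of_calculus)
    fix s :: real
    have "s\<^sup>2 * (b' s)\<^sup>2 - l * (s * (b s)\<^sup>2) = s\<^sup>2 * (b' s)\<^sup>2 + (- l * b s) * (s * b s)"
      by (simp add: power2_eq_square)
    also have "\<dots> = 2 * s * b' s * b s + s\<^sup>2 * b'' s * b s + s\<^sup>2 * b' s * b' s"
      unfolding ode[symmetric] by (simp add: power2_eq_square algebra_simps)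
    finally have *: "s\<^sup>2 * (b' s)\<^sup>2 - l * (s * (b s)\<^sup>2) = 2 * s * b' s * b s + s\<^sup>2 * b'' s * b s + s\<^sup>2 * b' s * b' s" .
    have "((\<lambda>s. s\<^sup>2 * b' s * b s) has_real_derivative s\<^sup>2 * (b' s)\<^sup>2 - l * (s * (b s)\<^sup>2)) (at s)"
      unfolding * by (auto intro!: derivative_eq_intros b b' simp: algebra_simps)
    then show "((\<lambda>s. s\<^sup>2 * b' s * b s) has_vector_derivative s\<^sup>2 * (b' s)\<^sup>2 - l * (s * (b s)\<^sup>2)) (at s within {0..1})"
      by (simp add: has_real_derivative_iff_has_vector_derivative has_vector_derivative_at_within)
  qed simp
  then have "integral {0..1} (\<lambda>s. s\<^sup>2 * (b' s)\<^sup>2 - l * (s * (b s)\<^sup>2)) = b' 1 * b 1" by (simp add: integral_unique)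
  moreover have "integral {0..1} (\<lambda>s. s\<^sup>2 * (b' s)\<^sup>2 - l * (s * (b s)\<^sup>2))
    = integral {0..1} (\<lambda>s. s\<^sup>2 * (b' s)\<^sup>2) - l * integral {0..1} (\<lambda>s. s * (b s)\<^sup>2)"
    by (subst integral_diff) (auto intro!: integrable_continuous_real continuous_intros bc)
  moreover have "b' 1 * b 1 = - (b 1)\<^sup>2 / 2"
  proof -
    have "b' 1 = - b 1 / 2" using b_1 by simp
    then show ?thesis by (simp add: power2_eq_square)
  qed
  ultimately show ?thesis unfolding extremal_solution_energy \<phi> by simp
qed

lemma extremal_energy_pos: "0 < disk_energy (mode_u 1 (\<lambda>s. of_real (b s)) (\<lambda>s. - of_real (b s)))"
proof -
  have bc: "continuous_on {0..1} b"
    using b by (meson DERIV_continuous continuous_at_imp_continuous_on)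
  have "integral {0..1} (\<lambda>s. s * (b s)\<^sup>2) \<noteq> 0"
  proof
    assume "integral {0..1} (\<lambda>s. s * (b s)\<^sup>2) = 0"
    then have "\<forall>s\<in>{0..1}. s * (b s)\<^sup>2 = 0"
      by (subst (asm) integral_eq_0_iff) (auto intro!: continuous_intros bc)
    from this[rule_format, of 1] b_pos[of 1] show False by simp
  qed
  moreover have "0 \<le> integral {0..1} (\<lambda>s. s * (b s)\<^sup>2)"
    by (intro integral_nonneg integrable_continuous_real continuous_intros bc) auto
  ultimately show ?thesis unfolding extremal_solution_energy by simp
qed

end

text \<open>Profiles are given for every m and the modes outside \<open>I\<close> vanish, so two
  decompositions with different index sets can be added over the union of the sets.\<close>

definition mode_sum :: "(complex \<Rightarrow> complex) \<Rightarrow> bool" where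
  "mode_sum \<phi> \<longleftrightarrow> (\<exists>I p p' q q'. finite I \<and> (\<forall>m. mode_profile m (p m) (p' m) (q m) (q' m)) \<and>
    (\<forall>m w. m \<notin> I \<longrightarrow> mode_phi m (p' m) (q m) (q' m) w = 0) \<and>
    \<phi> = (\<lambda>w. \<Sum>m\<in>I. mode_phi m (p' m) (q m) (q' m) w))"

lemma mode_profile_zero: "mode_profile m (\<lambda>_. 0) (\<lambda>_. 0) (\<lambda>_. 0) (\<lambda>_. 0)"
  by (simp add: mode_profile_def)

lemma mode_profile_add:
  assumes "mode_profile m p p' q q'" "mode_profile m r r' t t'"
  shows "mode_profile m (\<lambda>s. p s + r s) (\<lambda>s. p' s + r' s) (\<lambda>s. q s + t s) (\<lambda>s. q' s + t' s)"
  using assms unfolding mode_profile_def by (auto intro!: has_vector_derivative_add continuous_intros)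

lemma mode_sum_single:
  assumes "mode_profile n p p' q q'"
  shows "mode_sum (mode_phi n p' q q')"
  unfolding mode_sum_def
proof (intro exI conjI allI impI)
  show "mode_profile m (if m = n then p else (\<lambda>_. 0)) (if m = n then p' else (\<lambda>_. 0))
    (if m = n then q else (\<lambda>_. 0)) (if m = n then q' else (\<lambda>_. 0))" for m
    using assms by (simp add: mode_profile_zero)
  show "mode_phi n p' q q' = (\<lambda>w. \<Sum>m\<in>{n}. mode_phi m (if m = n then p' else (\<lambda>_. 0))
    (if m = n then q else (\<lambda>_. 0)) (if m = n then q' else (\<lambda>_. 0)) w)" by simp
qed (auto simp: mode_phi_def)

lemma mode_sum_add:
  assumes "mode_sum \<phi>" "mode_sum \<psi>"
  shows "mode_sum (\<lambda>w. \<phi> w + \<psi> w)"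
proof -
  obtain I p p' q q' where 1: "finite I" "\<And>m. mode_profile m (p m) (p' m) (q m) (q' m)"
    "\<And>m w. m \<notin> I \<Longrightarrow> mode_phi m (p' m) (q m) (q' m) w = 0"
    "\<phi> = (\<lambda>w. \<Sum>m\<in>I. mode_phi m (p' m) (q m) (q' m) w)"
    using assms(1) unfolding mode_sum_def by blast
  obtain J r r' t t' where 2: "finite J" "\<And>m. mode_profile m (r m) (r' m) (t m) (t' m)"
    "\<And>m w. m \<notin> J \<Longrightarrow> mode_phi m (r' m) (t m) (t' m) w = 0"
    "\<psi> = (\<lambda>w. \<Sum>m\<in>J. mode_phi m (r' m) (t m) (t' m) w)"
    using assms(2) unfolding mode_sum_def by blast
  have add: "mode_phi m (\<lambda>s. p' m s + r' m s) (\<lambda>s. q m s + t m s) (\<lambda>s. q' m s + t' m s) w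
    = mode_phi m (p' m) (q m) (q' m) w + mode_phi m (r' m) (t m) (t' m) w" for m w
    by (simp add: mode_phi_def algebra_simps)
  have "\<phi> w = (\<Sum>m\<in>I \<union> J. mode_phi m (p' m) (q m) (q' m) w)" for w
    unfolding 1(4) using 1 2 by (intro sum.mono_neutral_left) auto
  moreover have "\<psi> w = (\<Sum>m\<in>I \<union> J. mode_phi m (r' m) (t m) (t' m) w)" for w
    unfolding 2(4) using 1 2 by (intro sum.mono_neutral_left) auto
  ultimately have "(\<lambda>w. \<phi> w + \<psi> w) = (\<lambda>w. \<Sum>m\<in>I \<union> J. mode_phi m (\<lambda>s. p' m s + r' m s) (\<lambda>s. q m s + t m s) (\<lambda>s. q' m s + t' m s) w)"
    by (simp add: add sum.distrib)
  moreover have "finite (I \<union> J)" using 1 2 by simp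
  ultimately show ?thesis unfolding mode_sum_def
    using mode_profile_add[OF 1(2) 2(2)] add 1(3) 2(3)
    by (intro exI[of _ "I \<union> J"] exI[of _ "\<lambda>m s. p m s + r m s"] exI[of _ "\<lambda>m s. p' m s + r' m s"]
      exI[of _ "\<lambda>m s. q m s + t m s"] exI[of _ "\<lambda>m s. q' m s + t' m s"]) auto
qed

text \<open>Pairing factors w and cnj w into |w|^2 leaves a pure power of w if i > j, and of cnj w
  or a constant otherwise; this decides which half of \<open>mode_phi\<close> is used.\<close>

lemma mode_sum_monomial: "mode_sum (\<lambda>w. c * w ^ i * cnj w ^ j)"
proof -
  have abs2: "of_real (((cmod w)\<^sup>2) ^ k) = w ^ k * cnj w ^ k" for w k
    unfolding of_real_power[of _ k] complex_norm_square by (simp add: power_mult_distrib)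
  have pow: "((\<lambda>s. of_real (s ^ k) :: complex) has_vector_derivative of_real (real k * s ^ (k - 1))) (at s)" for k s
    by (rule has_vector_derivative_of_real) (auto intro!: derivative_eq_intros)
  show ?thesis
  proof (cases "i > j")
    case True
    \<comment> \<open>\<open>mode_phi\<close> carries w^(n+1), hence the extra -1. As q = 0, the
      antiderivative of c s^j must vanish at 1.\<close>
    define n where "n = i - j - 1"
    have "((\<lambda>s. c * (of_real (s ^ (j + 1)) - 1) / of_nat (j + 1)) has_vector_derivative c * of_real (s ^ j)) (at s)" for s
    proof -
      have "((\<lambda>s. (c / of_nat (j + 1)) * (of_real (s ^ (j + 1)) - 1)) has_vector_derivative
        (c / of_nat (j + 1)) * (of_real (real (j + 1) * s ^ (j + 1 - 1)) - 0)) (at s)"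
        by (intro has_vector_derivative_mult_right has_vector_derivative_diff has_vector_derivative_const pow)
      moreover have "(c / of_nat (j + 1)) * (of_real (real (j + 1) * s ^ (j + 1 - 1)) - 0) = c * of_real (s ^ j)"
        by (simp add: field_simps flip: of_nat_Suc del: of_nat_Suc)
      ultimately show ?thesis by simp
    qed
    then have "mode_profile n (\<lambda>s. c * (of_real (s ^ (j + 1)) - 1) / of_nat (j + 1)) (\<lambda>s. c * of_real (s ^ j)) (\<lambda>_. 0) (\<lambda>_. 0)"
      unfolding mode_profile_def by (auto intro!: continuous_intros)
    from mode_sum_single[OF this]
    have "mode_sum (mode_phi n (\<lambda>s. c * of_real (s ^ j)) (\<lambda>_. 0) (\<lambda>_. 0))" .
    moreover have "mode_phi n (\<lambda>s. c * of_real (s ^ j)) (\<lambda>_. 0) (\<lambda>_. 0) = (\<lambda>w. c * w ^ i * cnj w ^ j)"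
    proof (rule ext)
      fix w :: complex
      have "Suc n + j = i" using True by (simp add: n_def)
      then have "w ^ i = w ^ Suc n * w ^ j" by (metis power_add)
      then show "mode_phi n (\<lambda>s. c * of_real (s ^ j)) (\<lambda>_. 0) (\<lambda>_. 0) w = c * w ^ i * cnj w ^ j"
        unfolding mode_phi_def abs2 by (simp only:) simp
    qed
    ultimately show ?thesis by (simp only:)
  next
    case False
    \<comment> \<open>\<open>mode_phi\<close> carries cnj w to the power n - 1, hence the extra 1;
      it also makes n positive. Applied to k s^i, the operator n q + s q' multiplies by n + i = j +
      1, which is divided out in k.\<close>
    define n where "n = j - i + 1"
    define k where "k = c / of_nat (j + 1)"
    define q where "q s = k * of_real (s ^ i)" for s
    define q' where "q' s = k * of_real (real i * s ^ (i - 1))" for s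
    have "(q has_vector_derivative q' s) (at s)" for s
      unfolding q_def q'_def by (intro has_vector_derivative_mult_right pow)
    moreover have "continuous_on UNIV q'" unfolding q'_def[abs_def]
      by (intro continuous_on_mult continuous_on_const continuous_on_of_real continuous_on_power continuous_on_id)
    ultimately have "mode_profile n (\<lambda>_. - cnj (q 1)) (\<lambda>_. 0) q q'"
      unfolding mode_profile_def by (auto simp: n_def)
    from mode_sum_single[OF this] have "mode_sum (mode_phi n (\<lambda>_. 0) q q')" .
    moreover have "mode_phi n (\<lambda>_. 0) q q' = (\<lambda>w. c * w ^ i * cnj w ^ j)"
    proof (rule ext)
      fix w :: complex
      have "of_nat n * q s + of_real s * q' s = c * of_real (s ^ i)" for s
      proof -
        have "of_nat n * q s + of_real s * q' s = k * (of_nat n + of_nat i) * of_real (s ^ i)"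
          unfolding q_def q'_def by (cases i) (auto simp: algebra_simps)
        also have "of_nat n + of_nat i = (of_nat (j + 1) :: complex)"
          using False by (simp add: n_def flip: of_nat_add)
        finally show ?thesis by (simp add: k_def del: of_nat_add of_nat_Suc)
      qed
      moreover have "cnj w ^ j = cnj w ^ (n - 1) * cnj w ^ i"
        using False by (simp add: n_def flip: power_add)
      ultimately show "mode_phi n (\<lambda>_. 0) q q' w = c * w ^ i * cnj w ^ j"
        unfolding mode_phi_def by (simp only: abs2) (simp add: mult_ac)
    qed
    ultimately show ?thesis by (simp only:)
  qed
qed

section \<open>Real polynomials on the plane as polynomials in \<open>w\<close> and
  \<open>cnj w\<close>\<close>

inductive zpoly :: "(complex \<Rightarrow> complex) \<Rightarrow> bool" where
  zero: "zpoly (\<lambda>w. 0)"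
| add_monomial: "zpoly f \<Longrightarrow> zpoly (\<lambda>w. f w + c * w ^ i * cnj w ^ j)"

lemma zpoly_monomial: "zpoly (\<lambda>w. c * w ^ i * cnj w ^ j)"
  using add_monomial[OF zero] by simp

lemma zpoly_add: "zpoly g \<Longrightarrow> zpoly f \<Longrightarrow> zpoly (\<lambda>w. f w + g w)"
proof (induction rule: zpoly.induct)
  case (add_monomial g c i j)
  then show ?case using zpoly.add_monomial[of "\<lambda>w. f w + g w"] by (simp add: add.assoc)
qed simp

lemma zpoly_monomial_mult: "zpoly f \<Longrightarrow> zpoly (\<lambda>w. (c * w ^ i * cnj w ^ j) * f w)"
proof (induction rule: zpoly.induct)
  case (add_monomial f d k m)
  have "zpoly (\<lambda>w. c * w ^ i * cnj w ^ j * f w + (c * d) * w ^ (i + k) * cnj w ^ (j + m))"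
    by (rule zpoly.add_monomial) (rule add_monomial.IH)
  moreover have "c * w ^ i * cnj w ^ j * f w + (c * d) * w ^ (i + k) * cnj w ^ (j + m)
    = (c * w ^ i * cnj w ^ j) * (f w + d * w ^ k * cnj w ^ m)" for w
    by (simp add: algebra_simps power_add)
  ultimately show ?case by simp
qed (simp add: zpoly.zero)

lemma zpoly_mult: "zpoly g \<Longrightarrow> zpoly f \<Longrightarrow> zpoly (\<lambda>w. f w * g w)"
proof (induction rule: zpoly.induct)
  case (add_monomial g c i j)
  have "zpoly (\<lambda>w. f w * g w + (c * w ^ i * cnj w ^ j) * f w)"
    using add_monomial by (intro zpoly_add zpoly_monomial_mult)
  then show ?case by (simp add: algebra_simps)
qed (simp add: zpoly.zero)

lemma zpoly_real_polynomial_function: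
  "real_polynomial_function g \<Longrightarrow> zpoly (\<lambda>w. of_real (g w))" for g :: "complex \<Rightarrow> real"
proof (induction rule: real_polynomial_function.induct)
  case (linear g)
  interpret bounded_linear g by fact
  \<comment> \<open>A real-linear g is g(1) Re w + g(i) Im w, with Re w = (w + cnj w)/2 and Im w =
    (w - cnj w)/(2 i).\<close>
  have "(\<lambda>w. of_real (g w)) = (\<lambda>w. (of_real (g 1) / 2 + of_real (g \<i>) / (2 * \<i>)) * w ^ 1 * cnj w ^ 0
    + (of_real (g 1) / 2 - of_real (g \<i>) / (2 * \<i>)) * w ^ 0 * cnj w ^ 1)"
  proof (rule ext)
    fix w
    have "w = Re w *\<^sub>R 1 + Im w *\<^sub>R \<i>" by (simp add: complex_eq_iff)
    then have "g w = Re w * g 1 + Im w * g \<i>" by (metis add scaleR real_scaleR_def)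
    then show "of_real (g w) = (of_real (g 1) / 2 + of_real (g \<i>) / (2 * \<i>)) * w ^ 1 * cnj w ^ 0
      + (of_real (g 1) / 2 - of_real (g \<i>) / (2 * \<i>)) * w ^ 0 * cnj w ^ 1"
      by (simp add: complex_eq_iff field_simps)
  qed
  then show ?case by (rule ssubst) (intro zpoly_add zpoly_monomial)
next
  case (const c)
  show ?case using zpoly_monomial[of "of_real c" 0 0] by simp
next
  case (add f g)
  then show ?case by (simp add: zpoly_add)
next
  case (mult f g)
  then show ?case by (simp add: zpoly_mult)
qed

lemma zpoly_polynomial_function:
  fixes g :: "complex \<Rightarrow> complex"
  assumes "polynomial_function g"
  shows "zpoly g"
proof -
  have "real_polynomial_function (Re \<circ> g)" "real_polynomial_function (Im \<circ> g)"
    using assms unfolding polynomial_function_def by (auto intro: bounded_linear_Re bounded_linear_Im)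
  then have "zpoly (\<lambda>w. of_real ((Re \<circ> g) w))" "zpoly (\<lambda>w. of_real ((Im \<circ> g) w))"
    by (auto dest: zpoly_real_polynomial_function)
  then have "zpoly (\<lambda>w. of_real ((Re \<circ> g) w) + (\<i> * w ^ 0 * cnj w ^ 0) * of_real ((Im \<circ> g) w))"
    by (intro zpoly_add zpoly_monomial_mult)
  moreover have "(\<lambda>w. of_real ((Re \<circ> g) w) + (\<i> * w ^ 0 * cnj w ^ 0) * of_real ((Im \<circ> g) w)) = g"
    by (auto simp: complex_eq_iff)
  ultimately show ?thesis by simp
qed

lemma zpoly_mode_sum: "zpoly f \<Longrightarrow> mode_sum f"
proof (induction rule: zpoly.induct)
  case zero
  then show ?case using mode_sum_single[OF mode_profile_zero, of 0] by (simp add: mode_phi_def[abs_def])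
next
  case (add_monomial f c i j)
  then show ?case by (intro mode_sum_add mode_sum_monomial)
qed

text \<open>The transform is handed on as a function u continuous on the whole plane, which supplies
  its measurability and identifies \<open>L2sq u\<close> with the real number
  \<open>disk_energy u\<close>.\<close>

lemma (in neumann) polynomial_energy_bound:
  assumes "polynomial_function \<phi>"
  obtains u where "continuous_on UNIV u" "\<And>z. z \<in> diskD \<Longrightarrow> cauchyP \<phi> z = u z"
    "l * disk_energy u \<le> disk_energy \<phi>"
proof -
  obtain I p p' q q' where I: "finite I" and prof: "\<And>m. mode_profile m (p m) (p' m) (q m) (q' m)"
    and \<phi>: "\<phi> = (\<lambda>w. \<Sum>m\<in>I. mode_phi m (p' m) (q m) (q' m) w)"
    using zpoly_mode_sum[OF zpoly_polynomial_function[OF assms]] unfolding mode_sum_def by blast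
  show ?thesis
  proof
    let ?u = "\<lambda>w. \<Sum>m\<in>I. mode_u m (p m) (q m) w"
    show "continuous_on UNIV ?u" by (intro continuous_on_sum continuous_mode_u[OF prof])
    show "cauchyP \<phi> z = ?u z" if "z \<in> diskD" for z
      unfolding \<phi> using that by (subst cauchyP_sum) (auto simp: continuous_mode_phi[OF prof] cauchyP_mode[OF prof])
    show "l * disk_energy ?u \<le> disk_energy \<phi>"
      unfolding \<phi> disk_energy_mode_u[OF I prof] disk_energy_mode_phi[OF I prof] sum_distrib_left
      by (intro sum_mono mode_energy_inequality prof)
  qed
qed

section \<open>Passage to the limit\<close>

text \<open>Dominated convergence, with the kernels applied to the constant C as dominating
  functions. A uniform bound is what fits 1/(w - z), which is integrable but not square
  integrable.\<close>

lemma cauchyP_tendsto: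
  assumes \<phi>: "\<And>n. \<phi> n \<in> borel_measurable lebesgue" "\<psi> \<in> borel_measurable lebesgue"
    and C: "\<And>n w. w \<in> diskD \<Longrightarrow> cmod (\<phi> n w) \<le> C" "\<And>w. w \<in> diskD \<Longrightarrow> cmod (\<psi> w) \<le> C"
    and lim: "AE w in lebesgue. w \<in> diskD \<longrightarrow> (\<lambda>n. \<phi> n w) \<longlonglongrightarrow> \<psi> w" and z: "z \<in> diskD"
  shows "(\<lambda>n. cauchyP (\<phi> n) z) \<longlonglongrightarrow> cauchyP \<psi> z"
proof -
  have i: "integrable lebesgue (\<lambda>w. norm (indicator diskD w *\<^sub>R (complex_of_real C / (w - z))))"
    "integrable lebesgue (\<lambda>w. norm (indicator diskD w *\<^sub>R (z * cnj (complex_of_real C) / (1 - cnj w * z))))"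
    by (intro integrable_norm cauchy_kernels_integrable[where C = "\<bar>C\<bar>"] z; simp)+
  have "(\<lambda>n. LINT w|lebesgue. indicator diskD w *\<^sub>R (\<phi> n w / (w - z)))
      \<longlonglongrightarrow> (LINT w|lebesgue. indicator diskD w *\<^sub>R (\<psi> w / (w - z)))"
  proof (rule integral_dominated_convergence[OF _ _ i(1)])
    show "AE w in lebesgue. (\<lambda>n. indicator diskD w *\<^sub>R (\<phi> n w / (w - z))) \<longlonglongrightarrow> indicator diskD w *\<^sub>R (\<psi> w / (w - z))"
      using lim
    proof eventually_elim
      case (elim w)
      \<comment> \<open>At w = z the first quotient is 0 for every n, as a division by zero.\<close>
      then show ?case
        by (cases "w \<in> diskD"; cases "w = z") (auto intro!: tendsto_intros)
    qed
    show "AE w in lebesgue. norm (indicator diskD w *\<^sub>R (\<phi> n w / (w - z)))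
        \<le> norm (indicator diskD w *\<^sub>R (complex_of_real C / (w - z)))" for n
      using C(1)[of _ n] by (intro AE_I2) (auto simp: indicator_def norm_divide intro!: divide_right_mono order_trans[OF _ abs_ge_self])
  qed (intro measurable_cauchy_kernels \<phi>)+
  moreover have "(\<lambda>n. LINT w|lebesgue. indicator diskD w *\<^sub>R (z * cnj (\<phi> n w) / (1 - cnj w * z)))
      \<longlonglongrightarrow> (LINT w|lebesgue. indicator diskD w *\<^sub>R (z * cnj (\<psi> w) / (1 - cnj w * z)))"
  proof (rule integral_dominated_convergence[OF _ _ i(2)])
    show "AE w in lebesgue. (\<lambda>n. indicator diskD w *\<^sub>R (z * cnj (\<phi> n w) / (1 - cnj w * z)))
        \<longlonglongrightarrow> indicator diskD w *\<^sub>R (z * cnj (\<psi> w) / (1 - cnj w * z))"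
      using lim
    proof eventually_elim
      case (elim w)
      then show ?case
        using one_minus_cnj_mult_bound(2)[OF z, of w]
        by (cases "w \<in> diskD") (auto intro!: tendsto_intros)
    qed
    show "AE w in lebesgue. norm (indicator diskD w *\<^sub>R (z * cnj (\<phi> n w) / (1 - cnj w * z)))
        \<le> norm (indicator diskD w *\<^sub>R (z * cnj (complex_of_real C) / (1 - cnj w * z)))" for n
      using C(1)[of _ n] by (intro AE_I2)
        (auto simp: indicator_def norm_divide norm_mult intro!: divide_right_mono mult_left_mono order_trans[OF _ abs_ge_self])
  qed (intro measurable_cauchy_kernels \<phi>)+
  ultimately show ?thesis
    using cauchyP_eq[where C = C, OF \<phi>(1) _ z] cauchyP_eq[where C = C, OF \<phi>(2) _ z] C
    by (simp add: tendsto_intros)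
qed

lemma L2sq_bounded:
  assumes [measurable]: "\<phi> \<in> borel_measurable lebesgue" and C: "\<And>w. w \<in> diskD \<Longrightarrow> cmod (\<phi> w) \<le> C"
  shows "L2sq \<phi> = ennreal ((1 / pi) * (LINT w|lebesgue. indicator diskD w * (cmod (\<phi> w))\<^sup>2))"
proof -
  have [measurable]: "diskD \<in> sets lebesgue" by simp
  have "integrable lebesgue (\<lambda>w. indicator diskD w *\<^sub>R C\<^sup>2)"
    by (intro integrable_scaleR_left integrable_real_indicator)
      (auto simp: diskD_eq_ball emeasure_ball)
  then have i: "integrable lebesgue (\<lambda>w. indicator diskD w * (cmod (\<phi> w))\<^sup>2)"
    by (rule Bochner_Integration.integrable_bound)
      (use C in \<open>auto simp: indicator_def intro!: AE_I2 power_mono\<close>)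
  have "(\<integral>\<^sup>+ z. indicator diskD z * ennreal ((cmod (\<phi> z))\<^sup>2) \<partial>lebesgue)
    = (\<integral>\<^sup>+ z. ennreal (indicator diskD z * (cmod (\<phi> z))\<^sup>2) \<partial>lebesgue)"
    by (intro nn_integral_cong) (auto simp: indicator_def)
  also have "\<dots> = ennreal (LINT w|lebesgue. indicator diskD w * (cmod (\<phi> w))\<^sup>2)"
    by (rule nn_integral_eq_integral[OF i]) auto
  finally show ?thesis unfolding L2sq_def by (subst ennreal_mult') simp_all
qed

text \<open>The alternative g z = 0 covers points where the transform of an unbounded function has
  no convergent integral; there the integrand of g is 0 and lies below every lower limit.\<close>

lemma L2sq_fatou:
  assumes meas: "\<And>n. (\<lambda>z. indicator diskD z *\<^sub>R f n z) \<in> borel_measurable lebesgue"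
    and lim: "\<And>z. z \<in> diskD \<Longrightarrow> (\<lambda>n. f n z) \<longlonglongrightarrow> g z \<or> g z = 0"
    and bound: "\<And>n. L2sq (f n) \<le> ennreal (c n)" and c: "c \<longlonglongrightarrow> c0"
  shows "L2sq g \<le> ennreal c0"
proof -
  let ?E = "\<lambda>f. \<integral>\<^sup>+ z. indicator diskD z * ennreal ((cmod (f z))\<^sup>2) \<partial>lebesgue"
  have E: "?E f = ennreal pi * L2sq f" for f
    unfolding L2sq_def by (simp add: mult.assoc[symmetric] flip: ennreal_mult')
  have m: "(\<lambda>z. indicator diskD z * ennreal ((cmod (f n z))\<^sup>2)) \<in> borel_measurable lebesgue" for n
  proof -
    have "(\<lambda>z. indicator diskD z * ennreal ((cmod (f n z))\<^sup>2)) = (\<lambda>z. ennreal ((cmod (indicator diskD z *\<^sub>R f n z))\<^sup>2))"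
      by (auto simp: indicator_def)
    moreover have "(\<lambda>z. ennreal ((cmod (indicator diskD z *\<^sub>R f n z))\<^sup>2)) \<in> borel_measurable lebesgue"
      by (rule measurable_compose[OF meas]) measurable
    ultimately show ?thesis by (simp only:)
  qed
  have "?E g \<le> (\<integral>\<^sup>+ z. liminf (\<lambda>n. indicator diskD z * ennreal ((cmod (f n z))\<^sup>2)) \<partial>lebesgue)"
  proof (rule nn_integral_mono)
    fix z
    show "indicator diskD z * ennreal ((cmod (g z))\<^sup>2) \<le> liminf (\<lambda>n. indicator diskD z * ennreal ((cmod (f n z))\<^sup>2))"
    proof (cases "z \<in> diskD \<and> g z \<noteq> 0")
      case True
      then have "(\<lambda>n. ennreal ((cmod (f n z))\<^sup>2)) \<longlonglongrightarrow> ennreal ((cmod (g z))\<^sup>2)"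
        using lim[of z] by (auto intro!: tendsto_intros)
      from lim_imp_Liminf[OF sequentially_bot this] show ?thesis using True by simp
    qed auto
  qed
  also have "\<dots> \<le> liminf (\<lambda>n. ?E (f n))" by (rule nn_integral_liminf[OF m])
  also have "\<dots> \<le> liminf (\<lambda>n. ennreal (pi * c n))"
    unfolding E using bound by (intro Liminf_mono always_eventually allI) (simp add: ennreal_mult' mult_left_mono)
  also have "\<dots> = ennreal (pi * c0)"
    using c by (intro lim_imp_Liminf) (auto intro!: tendsto_intros)
  finally have "?E g \<le> ennreal (pi * c0)" .
  then have "ennreal (1 / pi) * ?E g \<le> ennreal (1 / pi) * ennreal (pi * c0)" by (intro mult_left_mono) auto
  also have "\<dots> = ennreal c0" by (subst ennreal_mult'[symmetric]) auto
  finally show ?thesis unfolding L2sq_def .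
qed

text \<open>Measurability yields continuous functions converging almost everywhere, but without a
  common bound. The nearest-point projection \<open>r\<close> onto the disk of radius C supplies one
  and fixes the values of \<phi>, so limits are kept. Stone-Weierstrass then costs an error below
  1/(n+1) on the closed disk, hence the bound C + 1.\<close>

lemma polynomial_approximation:
  fixes \<phi> :: "complex \<Rightarrow> complex"
  assumes \<phi>: "\<phi> \<in> borel_measurable lebesgue" "\<And>w. w \<in> diskD \<Longrightarrow> cmod (\<phi> w) \<le> C"
  obtains p where "\<And>n. polynomial_function (p n)" "\<And>n w. w \<in> diskD \<Longrightarrow> cmod (p n w) \<le> C + 1"
    "AE w in lebesgue. w \<in> diskD \<longrightarrow> (\<lambda>n::nat. p n w) \<longlonglongrightarrow> \<phi> w"
proof -
  have "\<phi> measurable_on diskD"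
    using \<phi>(1) by (rule lebesgue_measurable_imp_measurable_on) simp
  then obtain N g where N: "negligible N" and g: "\<And>n. continuous_on UNIV (g n)"
    and lim: "\<And>w. w \<notin> N \<Longrightarrow> (\<lambda>n. g n w) \<longlonglongrightarrow> (if w \<in> diskD then \<phi> w else 0)"
    unfolding measurable_on_def by blast
  have "0 \<le> C" using order_trans[OF norm_ge_zero \<phi>(2)[of 0]] by (simp add: diskD_def)
  then have K: "convex (cball (0::complex) C)" "closed (cball (0::complex) C)" "cball (0::complex) C \<noteq> {}" by auto
  define r where "r = closest_point (cball (0::complex) C)"
  have r: "continuous_on S r" for S unfolding r_def by (rule continuous_on_closest_point[OF K])
  have r_le: "cmod (r y) \<le> C" for y
    using closest_point_in_set[OF K(2,3), of y] by (simp add: r_def)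
  define h where "h n = r \<circ> g n" for n
  have h: "continuous_on UNIV (h n)" for n
    unfolding h_def by (intro continuous_on_compose g r)
  have "\<exists>p. polynomial_function p \<and> (\<forall>w\<in>cball 0 1. cmod (h n w - p w) < 1 / real (Suc n))" for n
    by (rule Stone_Weierstrass_polynomial_function) (auto intro: continuous_on_subset[OF h])
  then obtain p where p: "\<And>n. polynomial_function (p n)"
    and hp: "\<And>n w. w \<in> cball 0 1 \<Longrightarrow> cmod (h n w - p n w) < 1 / real (Suc n)" by metis
  show ?thesis
  proof
    show "cmod (p n w) \<le> C + 1" if "w \<in> diskD" for n w
    proof -
      have "cmod (h n w - p n w) < 1 / real (Suc n)" using hp that by (auto simp: diskD_def)
      also have "\<dots> \<le> 1" by simp
      finally show ?thesis
        using norm_triangle_ineq4[of "h n w" "h n w - p n w"] r_le[of "g n w"] by (simp add: h_def)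
    qed
    have "AE w in lebesgue. w \<notin> N" using N by (intro AE_not_in) (simp add: negligible_iff_null_sets)
    then show "AE w in lebesgue. w \<in> diskD \<longrightarrow> (\<lambda>n. p n w) \<longlonglongrightarrow> \<phi> w"
    proof (eventually_elim, intro impI)
      fix w assume "w \<notin> N" and w: "w \<in> diskD"
      then have "(\<lambda>n. g n w) \<longlonglongrightarrow> \<phi> w" using lim[of w] by simp
      then have "(\<lambda>n. r (g n w)) \<longlonglongrightarrow> r (\<phi> w)"
        using r[of UNIV] by (auto simp: continuous_on_eq_continuous_at intro: isCont_tendsto_compose)
      moreover have "r (\<phi> w) = \<phi> w" unfolding r_def using \<phi>(2)[OF w] by (intro closest_point_self) simp
      ultimately have hl: "(\<lambda>n. h n w) \<longlonglongrightarrow> \<phi> w" by (simp add: h_def)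
      have "(\<lambda>n. h n w - p n w) \<longlonglongrightarrow> 0"
      proof (rule Lim_null_comparison)
        show "eventually (\<lambda>n. norm (h n w - p n w) \<le> 1 / real (Suc n)) sequentially"
          using hp[of w] w by (intro always_eventually allI less_imp_le) (auto simp: diskD_def)
        show "(\<lambda>n. 1 / real (Suc n)) \<longlonglongrightarrow> 0" by (rule LIMSEQ_Suc[OF lim_1_over_n])
      qed
      from tendsto_diff[OF hl this] show "(\<lambda>n. p n w) \<longlonglongrightarrow> \<phi> w" by simp
    qed
  qed (rule p)
qed

text \<open>The energies of the approximating polynomials converge by dominated convergence, and
  Fatou carries the inequality over. Measurability is recorded along with the bound because these
  transforms form the sequence in the next application of Fatou.\<close>

lemma (in neumann) cauchyP_bound_bounded:
  assumes \<phi>: "\<phi> \<in> borel_measurable lebesgue" "\<And>w. w \<in> diskD \<Longrightarrow> cmod (\<phi> w) \<le> C"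
  shows "(\<lambda>z. indicator diskD z *\<^sub>R cauchyP \<phi> z) \<in> borel_measurable lebesgue"
    and "L2sq (cauchyP \<phi>) \<le> ennreal (1 / l * enn2real (L2sq \<phi>))"
proof -
  obtain p where p: "\<And>n. polynomial_function (p n)" "\<And>n w. w \<in> diskD \<Longrightarrow> cmod (p n w) \<le> C + 1"
    "AE w in lebesgue. w \<in> diskD \<longrightarrow> (\<lambda>n::nat. p n w) \<longlonglongrightarrow> \<phi> w"
    using polynomial_approximation[OF \<phi>] by blast
  have "\<exists>u. continuous_on UNIV u \<and> (\<forall>z\<in>diskD. cauchyP (p n) z = u z) \<and> l * disk_energy u \<le> disk_energy (p n)" for n
    using polynomial_energy_bound[OF p(1), of n] by metis
  then obtain u where u: "\<And>n. continuous_on UNIV (u n)" "\<And>n z. z \<in> diskD \<Longrightarrow> cauchyP (p n) z = u n z"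
    "\<And>n. l * disk_energy (u n) \<le> disk_energy (p n)" by metis
  have pc: "continuous_on UNIV (p n)" for n using p(1) by (rule continuous_on_polymonial_function)
  have pm: "p n \<in> borel_measurable lebesgue" for n by (rule continuous_measurable_lebesgue[OF pc])
  have lim: "(\<lambda>n. u n z) \<longlonglongrightarrow> cauchyP \<phi> z" if "z \<in> diskD" for z
    using cauchyP_tendsto[OF pm \<phi>(1) p(2) _ p(3) that] \<phi>(2) u(2)[OF that] by (simp add: le_add_same_cancel1 add_increasing2)
  have um: "(\<lambda>z. indicator diskD z *\<^sub>R u n z) \<in> borel_measurable lebesgue" for n
    using continuous_measurable_lebesgue[OF u(1)[of n]]
    by (intro borel_measurable_scaleR borel_measurable_indicator) auto
  show "(\<lambda>z. indicator diskD z *\<^sub>R cauchyP \<phi> z) \<in> borel_measurable lebesgue"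
  proof (rule borel_measurable_LIMSEQ_metric[OF um])
    show "(\<lambda>n. indicator diskD z *\<^sub>R u n z) \<longlonglongrightarrow> indicator diskD z *\<^sub>R cauchyP \<phi> z" for z
      using lim[of z] by (cases "z \<in> diskD") auto
  qed
  define e where "e = (1 / pi) * (LINT w|lebesgue. indicator diskD w * (cmod (\<phi> w))\<^sup>2)"
  have "0 \<le> e" unfolding e_def by (auto intro!: Bochner_Integration.integral_nonneg)
  have e: "L2sq \<phi> = ennreal e" unfolding e_def by (rule L2sq_bounded[OF \<phi>])
  have pe: "disk_energy (p n) = (1 / pi) * (LINT w|lebesgue. indicator diskD w * (cmod (p n w))\<^sup>2)" for n
  proof -
    have "(\<lambda>w. (cmod (p n w))\<^sup>2) \<in> borel_measurable borel"
      by (intro borel_measurable_continuous_onI continuous_intros pc)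
    then show ?thesis unfolding disk_energy_def diskD_eq_ball
      by (subst integral_completion) (auto intro!: borel_measurable_times borel_measurable_indicator)
  qed
  have elim: "(\<lambda>n. disk_energy (p n)) \<longlonglongrightarrow> e"
    unfolding pe e_def
  proof (intro tendsto_mult tendsto_const integral_dominated_convergence[where w = "\<lambda>w. indicator diskD w *\<^sub>R (C + 1)\<^sup>2"])
    show "integrable lebesgue (\<lambda>w. indicator diskD w *\<^sub>R (C + 1)\<^sup>2)"
      by (intro integrable_scaleR_left integrable_real_indicator)
        (auto simp: diskD_eq_ball emeasure_ball)
    show "AE w in lebesgue. (\<lambda>n. indicator diskD w * (cmod (p n w))\<^sup>2) \<longlonglongrightarrow> indicator diskD w * (cmod (\<phi> w))\<^sup>2"
      using p(3)
    proof eventually_elim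
      case (elim w)
      then show ?case by (cases "w \<in> diskD") (auto intro!: tendsto_intros)
    qed
    show "AE w in lebesgue. norm (indicator diskD w * (cmod (p n w))\<^sup>2) \<le> indicator diskD w *\<^sub>R (C + 1)\<^sup>2" for n
      using p(2)[of _ n] by (intro AE_I2) (auto simp: indicator_def intro!: power_mono)
  qed (use pm \<phi>(1) in \<open>auto intro!: borel_measurable_times borel_measurable_indicator\<close>)
  have "L2sq (cauchyP \<phi>) \<le> ennreal (1 / l * e)"
  proof (rule L2sq_fatou[OF um])
    show "(\<lambda>n. u n z) \<longlonglongrightarrow> cauchyP \<phi> z \<or> cauchyP \<phi> z = 0" if "z \<in> diskD" for z using lim[OF that] ..
    show "L2sq (u n) \<le> ennreal (1 / l * disk_energy (p n))" for n
      using u(3)[of n] l_pos by (simp add: L2sq_eq_disk_energy[OF u(1)] ennreal_leI field_simps)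
    show "(\<lambda>n. 1 / l * disk_energy (p n)) \<longlonglongrightarrow> 1 / l * e" by (intro tendsto_mult tendsto_const elim)
  qed
  then show "L2sq (cauchyP \<phi>) \<le> ennreal (1 / l * enn2real (L2sq \<phi>))" using \<open>0 \<le> e\<close> by (simp add: e)
qed

text \<open>Truncation at height n does not increase the energy, so Fatou is applied with a constant
  bound. Where \<open>K \<phi>\<close> is integrable it dominates the truncated integrands, each of
  which equals it or 0 at any given w.\<close>

lemma (in neumann) cauchyP_bound:
  assumes "\<phi> \<in> L2D"
  shows "L2sq (cauchyP \<phi>) \<le> ennreal (1 / l * enn2real (L2sq \<phi>))"
proof -
  have [measurable]: "\<phi> \<in> borel_measurable lebesgue" and fin: "L2sq \<phi> < \<infinity>" using assms by (auto simp: L2D_def)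
  define \<phi>n where "\<phi>n n w = (if cmod (\<phi> w) \<le> real n then \<phi> w else 0)" for n w
  have m: "\<phi>n n \<in> borel_measurable lebesgue" for n unfolding \<phi>n_def[abs_def] by measurable
  have le: "cmod (\<phi>n n w) \<le> real n" for n w by (simp add: \<phi>n_def)
  show ?thesis
  proof (rule L2sq_fatou[where f = "\<lambda>n. cauchyP (\<phi>n n)"])
    show "(\<lambda>z. indicator diskD z *\<^sub>R cauchyP (\<phi>n n) z) \<in> borel_measurable lebesgue" for n
      by (rule cauchyP_bound_bounded(1)[OF m le])
    show "L2sq (cauchyP (\<phi>n n)) \<le> ennreal (1 / l * enn2real (L2sq \<phi>))" for n
    proof -
      have "L2sq (\<phi>n n) \<le> L2sq \<phi>"
        unfolding L2sq_def by (intro mult_left_mono nn_integral_mono) (auto simp: \<phi>n_def)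
      then have "enn2real (L2sq (\<phi>n n)) \<le> enn2real (L2sq \<phi>)" using fin by (intro enn2real_mono) auto
      then have "ennreal (1 / l * enn2real (L2sq (\<phi>n n))) \<le> ennreal (1 / l * enn2real (L2sq \<phi>))"
        using l_pos by (intro ennreal_leI mult_left_mono) auto
      with cauchyP_bound_bounded(2)[OF m le] show ?thesis by (rule order_trans)
    qed
    show "(\<lambda>n. 1 / l * enn2real (L2sq \<phi>)) \<longlonglongrightarrow> 1 / l * enn2real (L2sq \<phi>)" by simp
    fix z assume z: "z \<in> diskD"
    define K where "K \<psi> w = indicator diskD w *\<^sub>R (\<psi> w / (w - z) + z * cnj (\<psi> w) / (1 - cnj w * z))" for \<psi> w
    have P: "cauchyP \<psi> z = - ((1 / pi) *\<^sub>R (LINT w|lebesgue. K \<psi> w))" for \<psi>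
      by (simp add: cauchyP_def set_lebesgue_integral_def K_def)
    have Km: "K \<psi> \<in> borel_measurable lebesgue" if "\<psi> \<in> borel_measurable lebesgue" for \<psi>
      unfolding K_def[abs_def] scaleR_add_right by (intro borel_measurable_add measurable_cauchy_kernels that)
    show "(\<lambda>n. cauchyP (\<phi>n n) z) \<longlonglongrightarrow> cauchyP \<phi> z \<or> cauchyP \<phi> z = 0"
    proof (cases "integrable lebesgue (K \<phi>)")
      case True
      have "(\<lambda>n. LINT w|lebesgue. K (\<phi>n n) w) \<longlonglongrightarrow> (LINT w|lebesgue. K \<phi> w)"
      proof (rule integral_dominated_convergence[OF _ _ integrable_norm[OF True]])
        show "AE w in lebesgue. (\<lambda>n. K (\<phi>n n) w) \<longlonglongrightarrow> K \<phi> w"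
        proof (intro AE_I2 tendsto_eventually)
          fix w
          show "eventually (\<lambda>n. K (\<phi>n n) w = K \<phi> w) sequentially"
            using eventually_ge_at_top[of "nat \<lceil>cmod (\<phi> w)\<rceil>"]
          proof eventually_elim
            case (elim n)
            then have "cmod (\<phi> w) \<le> real n" by linarith
            then show ?case by (simp add: K_def \<phi>n_def)
          qed
        qed
        show "AE w in lebesgue. norm (K (\<phi>n n) w) \<le> norm (K \<phi> w)" for n
          by (intro AE_I2) (simp add: K_def \<phi>n_def)
      qed (use Km m in auto)
      then show ?thesis unfolding P by (intro disjI1 tendsto_intros)
    next
      case False
      \<comment> \<open>The Bochner integral of a non-integrable function is 0 by convention, so
        \<open>cauchyP \<phi> z = 0\<close>: the second alternative of
        \<open>L2sq_fatou\<close>.\<close>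
      then show ?thesis unfolding P by (simp add: not_integrable_integral_eq)
    qed
  qed
qed

section \<open>The extremal function and the value of the norm\<close>

lemma cauchyP_scaleR: "cauchyP (\<lambda>w. c *\<^sub>R \<phi> w) z = c *\<^sub>R cauchyP \<phi> z"
proof -
  have "(\<lambda>w. indicator diskD w *\<^sub>R (c *\<^sub>R \<phi> w / (w - z) + z * cnj (c *\<^sub>R \<phi> w) / (1 - cnj w * z)))
    = (\<lambda>w. c *\<^sub>R (indicator diskD w *\<^sub>R (\<phi> w / (w - z) + z * cnj (\<phi> w) / (1 - cnj w * z))))"
    by (auto simp: fun_eq_iff scaleR_conv_of_real algebra_simps)
  then have "(LINT w|lebesgue. indicator diskD w *\<^sub>R (c *\<^sub>R \<phi> w / (w - z) + z * cnj (c *\<^sub>R \<phi> w) / (1 - cnj w * z)))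
    = c *\<^sub>R (LINT w|lebesgue. indicator diskD w *\<^sub>R (\<phi> w / (w - z) + z * cnj (\<phi> w) / (1 - cnj w * z)))"
    by (simp only: integral_scaleR_right)
  then show ?thesis
    unfolding cauchyP_def set_lebesgue_integral_def by (simp only:) simp
qed

lemma disk_energy_scaleR: "disk_energy (\<lambda>w. c *\<^sub>R f w) = c\<^sup>2 * disk_energy f"
proof -
  have "(\<lambda>w. indicator (ball 0 1) w * (cmod (c *\<^sub>R f w))\<^sup>2) = (\<lambda>w. c\<^sup>2 * (indicator (ball 0 1) w * (cmod (f w))\<^sup>2))"
    by (simp add: power_mult_distrib mult.left_commute)
  then show ?thesis unfolding disk_energy_def by simp
qed

lemma L2norm_eq_sqrt: "L2sq f = ennreal e \<Longrightarrow> 0 \<le> e \<Longrightarrow> L2norm f = ennreal (sqrt e)"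
  by (simp add: L2norm_def)

lemma L2norm_eq_1_iff: "L2norm f = 1 \<longleftrightarrow> L2sq f = 1"
proof
  assume 1: "L2norm f = 1"
  then have fin: "L2sq f \<noteq> \<infinity>" by (auto simp: L2norm_def split: if_splits)
  then obtain e where e: "L2sq f = ennreal e" "0 \<le> e" by (cases "L2sq f") auto
  then have "ennreal (sqrt e) = ennreal 1" using 1 L2norm_eq_sqrt[of f e] by simp
  then show "L2sq f = 1" using e by (auto simp: ennreal_inj)
next
  assume "L2sq f = 1"
  then show "L2norm f = 1" using L2norm_eq_sqrt[of f 1] by simp
qed

text \<open>The energies of the extremal density and of its transform have ratio l, so scaling the
  density to energy 1 leaves energy 1/l for the transform. The supremum is therefore a
  maximum.\<close>

lemma (in neumann) norm_attained:
  obtains \<phi> where "\<phi> \<in> L2D" "L2norm \<phi> = 1" "L2norm (cauchyP \<phi>) = ennreal (sqrt (1 / l))"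
proof -
  define f where "f = mode_phi 1 (\<lambda>s. of_real (b' s)) (\<lambda>s. - of_real (b s)) (\<lambda>s. - of_real (b' s))"
  define u where "u = mode_u 1 (\<lambda>s. of_real (b s)) (\<lambda>s. - of_real (b s))"
  have fc: "continuous_on UNIV f" and uc: "continuous_on UNIV u"
    unfolding f_def u_def using continuous_mode_phi continuous_mode_u extremal_profile by blast+
  have E: "disk_energy f = l * disk_energy u" "0 < disk_energy u"
    unfolding f_def u_def by (rule extremal_energy, rule extremal_energy_pos)
  define c where "c = 1 / sqrt (disk_energy f)"
  have c2: "c\<^sup>2 * disk_energy f = 1" "c\<^sup>2 * disk_energy u = 1 / l"
    using E l_pos by (auto simp: c_def power_divide field_simps)
  define \<phi> where "\<phi> w = c *\<^sub>R f w" for w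
  have \<phi>c: "continuous_on UNIV \<phi>" unfolding \<phi>_def by (intro continuous_intros fc)
  have "disk_energy \<phi> = 1" unfolding \<phi>_def[abs_def] disk_energy_scaleR c2 ..
  then have "L2sq \<phi> = 1" by (simp add: L2sq_eq_disk_energy[OF \<phi>c])
  moreover have "L2sq (cauchyP \<phi>) = ennreal (1 / l)"
  proof -
    have "cauchyP \<phi> z = c *\<^sub>R u z" if "z \<in> diskD" for z
      unfolding \<phi>_def[abs_def] cauchyP_scaleR f_def u_def using cauchyP_mode[OF extremal_profile that] by simp
    then have "L2sq (cauchyP \<phi>) = L2sq (\<lambda>z. c *\<^sub>R u z)"
      unfolding L2sq_def by (intro arg_cong[where f="\<lambda>x. ennreal (1 / pi) * x"] nn_integral_cong) (auto simp: indicator_def)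
    also have "\<dots> = ennreal (disk_energy (\<lambda>z. c *\<^sub>R u z))"
      by (intro L2sq_eq_disk_energy continuous_intros uc)
    finally show ?thesis unfolding disk_energy_scaleR c2 .
  qed
  ultimately show ?thesis
    using l_pos \<phi>c by (intro that[of \<phi>] L2norm_eq_sqrt) (auto simp: L2norm_eq_1_iff L2D_def continuous_measurable_lebesgue)
qed

theorem theorem1p1:
  fixes \<alpha> :: real
  assumes "2 * besselJ 0 (2 / \<alpha>) - \<alpha> * besselJ 1 (2 / \<alpha>) = 0"
    and "1.08 \<le> \<alpha>" and "\<alpha> \<le> 1.09"
  shows "(SUP \<phi> \<in> {\<phi> \<in> L2D. L2norm \<phi> = 1}. L2norm (cauchyP \<phi>)) = ennreal \<alpha>"
proof -
  define l where "l = 1 / \<alpha>\<^sup>2"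
  obtain b b' b'' where "neumann l b b' b''"
    unfolding l_def by (rule neumann_profile_exists[OF assms(1,2)])
  then interpret neumann l b b' b'' .
  have sq: "sqrt (1 / l) = \<alpha>" using assms(2) by (simp add: l_def real_sqrt_unique)
  show ?thesis
  proof (rule antisym)
    show "(SUP \<phi> \<in> {\<phi> \<in> L2D. L2norm \<phi> = 1}. L2norm (cauchyP \<phi>)) \<le> ennreal \<alpha>"
    proof (rule SUP_least)
      fix \<phi> assume "\<phi> \<in> {\<phi> \<in> L2D. L2norm \<phi> = 1}"
      then have "\<phi> \<in> L2D" "L2sq \<phi> = 1" by (auto simp: L2norm_eq_1_iff)
      with cauchyP_bound have "L2sq (cauchyP \<phi>) \<le> ennreal (1 / l)" by fastforce
      then obtain e where e: "L2sq (cauchyP \<phi>) = ennreal e" "0 \<le> e" "e \<le> 1 / l"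
        using l_pos by (cases "L2sq (cauchyP \<phi>)") (auto simp: top_unique)
      then show "L2norm (cauchyP \<phi>) \<le> ennreal \<alpha>"
        using L2norm_eq_sqrt[OF e(1,2)] by (simp add: ennreal_leI flip: sq)
    qed
    obtain \<phi> where "\<phi> \<in> L2D" "L2norm \<phi> = 1" "L2norm (cauchyP \<phi>) = ennreal \<alpha>"
      using norm_attained unfolding sq by blast
    then show "ennreal \<alpha> \<le> (SUP \<phi> \<in> {\<phi> \<in> L2D. L2norm \<phi> = 1}. L2norm (cauchyP \<phi>))"
      by (intro SUP_upper2[of \<phi>]) auto
  qed
qed

end
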